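(* $\mathrm{CRT}_{\mathrm S}(4)=\tfrac{3}{2}$ and $\mathrm{CRT}_{\mathrm S}(5)=\tfrac{4}{3}$, where $\mathrm{CRT}_{\mathrm S}(k)$ denotes the strong circular repetition threshold on $k$ letters.
   Context: A word $w=w_1\cdots w_n$ has period $p\ge 1$ if $w_{i+p}=w_i$ for all $1\le i\le n-p$ (so $n$ is always a period). The exponent of a nonempty word is its length divided by its minimal period. Two words $x,y$ are conjugates if $x=uv$ and $y=vu$ for some words $u,v$. For a word $w$, the circular word $(w)$ is the set of all conjugates of $w$; its length is $|w|$. A word is a factor of $(w)$ if it is a (contiguous) factor of some conjugate of $w$. A (linear or circular) word is $\beta$-free if it has no factor of exponent greater than or equal to $\beta$. A word is $k$-ary if it is over an alphabet of $k$ letters. The strong circular repetition threshold is $$\mathrm{CRT}_{\mathrm S}(k)=\inf\{\beta : \text{there are } k\text{-ary } \beta\text{-free circular words of every (positive) length}\}.$$ *)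

theory Defs
  imports Complex_Main "HOL-Library.Sublist" "HOL-Library.Extended_Real"
begin

definition has_period :: "'a list \<Rightarrow> nat \<Rightarrow> bool" where
  "has_period w p \<longleftrightarrow> p \<ge> 1 \<and> (\<forall>i. i + p < length w \<longrightarrow> w ! (i + p) = w ! i)"

definition min_period :: "'a list \<Rightarrow> nat" where
  "min_period w = (LEAST p. has_period w p)"

(* Meaningful for nonempty words only. *)
definition exponent :: "'a list \<Rightarrow> real" where
  "exponent w = real (length w) / real (min_period w)"

definition conjugate :: "'a list \<Rightarrow> 'a list \<Rightarrow> bool" where
  "conjugate x y \<longleftrightarrow> (\<exists>u v. x = u @ v \<and> y = v @ u)"

definition circular_word :: "'a list \<Rightarrow> 'a list set" where
  "circular_word w = {w'. conjugate w w'}"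

(* The constant sublist is the contiguous factor relation. *)
definition circular_factor :: "'a list \<Rightarrow> 'a list set \<Rightarrow> bool" where
  "circular_factor x C \<longleftrightarrow> (\<exists>w\<in>C. sublist x w)"

definition circular_free :: "real \<Rightarrow> 'a list set \<Rightarrow> bool" where
  "circular_free \<beta> C \<longleftrightarrow> \<not> (\<exists>x. x \<noteq> [] \<and> circular_factor x C \<and> exponent x \<ge> \<beta>)"

(* The letters are 0, ..., k - 1.  The infimum is taken in the extended reals, so that
   it is infinite, rather than unspecified, when no real beta qualifies (e.g. k = 1). *)
definition CRT_S :: "nat \<Rightarrow> ereal" where
  "CRT_S k = Inf {ereal \<beta> | \<beta>. \<forall>n\<ge>1. \<exists>w :: nat list.
      length w = n \<and> set w \<subseteq> {..<k} \<and> circular_free \<beta> (circular_word w)}"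

end

theory Submission
  imports Defs "HOL-Combinatorics.Transposition"
begin

text \<open>
  Lower bound: a circular word of length k + 1 over k letters repeats a letter at circular distance
  at most (k + 1) div 2.

  Upper bound, with d = 2 for k = 4 and d = 3 for k = 5: a circular word of length n avoids all
  exponents greater than 1 + 1/d iff, for every p \<le> n/2, among any p div d + 1 consecutive
  positions some letter differs from the letter p positions later; the shift n - p is the shift p
  read backwards. Such words u are produced for all n by induction. Let the letters form the
  field with k elements and let G be a fixed block of length 10. Replace the j-th letter of u by the
  image of G under the affine map that sends 0 to u(j) and 1 to u(j+1). Two different affine maps agree
  in at most one point, so a repetition whose period is a multiple of 10 comes from a repetition in
  u; a repetition with any other long period is impossible since a short factor determines its
  position modulo 10. To reach lengths that are not multiples of 10, one word of suitable length,
  all of whose occurrences are recognised by short factors, is inserted into a single block; this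
  makes the distance between two equal factors on either side of it only larger.
\<close>

section \<open>Words without repetitions\<close>

text \<open>A circular word of length \<open>n\<close> is encoded as an \<open>n\<close>-periodic
  function, so that rotations become shifts of the argument. Since \<open>p + p div d + 1\<close> is
  the least length exceeding (1 + 1/d) p, the factor of that length at \<open>x\<close> must not
  have period \<open>p\<close>.\<close>

definition good :: "nat \<Rightarrow> nat \<Rightarrow> (nat \<Rightarrow> 'a) \<Rightarrow> bool" where
  "good d n u \<longleftrightarrow> (\<forall>x. u (x + n) = u x) \<and>
     (\<forall>p x. 1 \<le> p \<longrightarrow> 2 * p \<le> n \<longrightarrow> (\<exists>i\<le>p div d. u (x + i) \<noteq> u (x + p + i)))"

text \<open>For \<open>p\<close> above n/2 the definition is applied to the shift
  \<open>n - p\<close> at \<open>x + p\<close>. By periodicity it compares the same two letters, and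
  the smaller shift has the smaller bound on \<open>i\<close>.\<close>

lemma good_mismatch:
  assumes "good d n u" "1 \<le> p" "p < n"
  shows "\<exists>i\<le>p div d. u (x + i) \<noteq> u (x + p + i)"
proof (cases "2 * p \<le> n")
  case True
  then show ?thesis using assms unfolding good_def by blast
next
  case False
  then have "1 \<le> n - p" "2 * (n - p) \<le> n" using assms(3) by auto
  then obtain i where i: "i \<le> (n - p) div d" "u (x + p + i) \<noteq> u (x + p + (n - p) + i)"
    using assms(1) unfolding good_def by blast
  have eq: "x + p + (n - p) + i = (x + i) + n" using assms by simp
  have "u (x + p + (n - p) + i) = u (x + i)"
    unfolding eq using assms(1) unfolding good_def by blast
  then have "u (x + i) \<noteq> u (x + p + i)" using i(2) by simp
  moreover have "(n - p) div d \<le> p div d" using False by (intro div_le_mono) simp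
  ultimately show ?thesis using i(1) by (meson le_trans)
qed

lemma good_inj:
  assumes "good d n u" "inj \<pi>"
  shows "good d n (\<pi> \<circ> u)"
  using assms unfolding good_def by (simp add: inj_eq)

text \<open>Positions beyond the end of a list never agree, so the checks below are vacuous for
  repetitions that do not fit into the list.\<close>

fun agree :: "nat \<Rightarrow> 'a list \<Rightarrow> 'a list \<Rightarrow> bool" where
  "agree 0 xs ys = True"
| "agree (Suc e) (x # xs) (y # ys) = (x = y \<and> agree e xs ys)"
| "agree (Suc e) xs ys = False"

lemma agree_iff:
  "agree e xs ys \<longleftrightarrow> e \<le> length xs \<and> e \<le> length ys \<and> (\<forall>i<e. xs ! i = ys ! i)"
  by (induction e xs ys rule: agree.induct) (auto simp: All_less_Suc2)

fun norep :: "nat list \<Rightarrow> 'a list \<Rightarrow> 'a list \<Rightarrow> bool" where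
  "norep [] xs ys = True"
| "norep (e # es) xs ys = ((e = 0 \<or> \<not> agree e xs ys) \<and> norep es xs (tl ys))"

lemma norep_iff:
  "norep es xs ys \<longleftrightarrow> (\<forall>p<length es. es ! p \<noteq> 0 \<longrightarrow> \<not> agree (es ! p) xs (drop p ys))"
  by (induction es xs ys rule: norep.induct) (auto simp: All_less_Suc2 drop_Suc)

fun norep_upto :: "nat \<Rightarrow> nat list \<Rightarrow> 'a list \<Rightarrow> bool" where
  "norep_upto 0 es xs = True"
| "norep_upto (Suc n) es xs = (norep es xs (tl xs) \<and> norep_upto n es (tl xs))"

lemma norep_upto_iff:
  "norep_upto n es xs \<longleftrightarrow> (\<forall>x<n. norep es (drop x xs) (drop (Suc x) xs))"
  by (induction n es xs rule: norep_upto.induct) (auto simp: All_less_Suc2 drop_Suc)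

text \<open>Entry p - 1 belongs to the period p; a zero entry exempts the period q from the check
  (q = 0 exempts none).\<close>

definition excesses :: "nat \<Rightarrow> nat \<Rightarrow> nat \<Rightarrow> nat list" where
  "excesses d P q = map (\<lambda>p. if p = q then 0 else p div d + 1) [1..<P]"

lemma length_excesses [simp]: "length (excesses d P q) = P - 1"
  by (simp add: excesses_def)

lemma nth_excesses:
  "p < P - 1 \<Longrightarrow> excesses d P q ! p = (if Suc p = q then 0 else Suc p div d + 1)"
  by (simp add: excesses_def)

lemma norep_uptoD:
  assumes "norep_upto n (excesses d P q) xs" "x < n" "1 \<le> p" "p < P" "p \<noteq> q"
    "x + p + p div d < length xs"
  shows "\<exists>i\<le>p div d. xs ! (x + i) \<noteq> xs ! (x + p + i)"
proof -
  have "norep (excesses d P q) (drop x xs) (drop (Suc x) xs)"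
    using assms by (simp add: norep_upto_iff)
  moreover have "excesses d P q ! (p - 1) = p div d + 1"
    using assms by (simp add: nth_excesses)
  ultimately have "\<not> agree (p div d + 1) (drop x xs) (drop (p - 1) (drop (Suc x) xs))"
    using assms unfolding norep_iff by (metis Suc_eq_plus1 diff_less_mono length_excesses nat.simps(3))
  then show ?thesis
    using assms unfolding agree_iff by (auto simp: less_Suc_eq_le ac_simps)
qed

section \<open>Short factors that a good word may have\<close>

fun contexts :: "nat \<Rightarrow> nat \<Rightarrow> nat \<Rightarrow> nat list list" where
  "contexts k d 0 = [[]]"
| "contexts k d (Suc t) = concat (map (\<lambda>us. filter (\<lambda>vs. norep (excesses d 3 0) vs (tl vs))
     (map (\<lambda>c. c # us) [0..<k])) (contexts k d t))"

lemma in_contexts_Suc: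
  "us \<in> set (contexts k d (Suc t)) \<longleftrightarrow>
     (\<exists>c vs. us = c # vs \<and> c < k \<and> vs \<in> set (contexts k d t) \<and> norep (excesses d 3 0) us vs)"
  by force

declare contexts.simps(2) [simp del]

lemma agree_map:
  assumes "inj_on \<sigma> A" "set xs \<subseteq> A" "set ys \<subseteq> A"
  shows "agree e (map \<sigma> xs) (map \<sigma> ys) = agree e xs ys"
  using assms by (induction e xs ys rule: agree.induct) (auto dest: inj_onD)

lemma norep_map:
  assumes "inj_on \<sigma> A" "set xs \<subseteq> A" "set ys \<subseteq> A"
  shows "norep es (map \<sigma> xs) (map \<sigma> ys) = norep es xs ys"
proof -
  have "agree e (map \<sigma> xs) (drop p (map \<sigma> ys)) = agree e xs (drop p ys)" for e p
    using agree_map[OF assms(1,2), of "drop p ys" e] assms(3) set_drop_subset[of p ys]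
    by (simp add: drop_map subset_trans)
  then show ?thesis by (simp add: norep_iff)
qed

lemma contexts_subset: "us \<in> set (contexts k d t) \<Longrightarrow> set us \<subseteq> {..<k} \<and> length us = t"
  by (induction t arbitrary: us) (fastforce simp: in_contexts_Suc)+

lemma in_contexts_map:
  assumes "inj_on \<sigma> {..<k}" "set us \<subseteq> {..<k}" "\<And>x. x < k \<Longrightarrow> \<sigma> x < k"
  shows "map \<sigma> us \<in> set (contexts k d t) \<longleftrightarrow> us \<in> set (contexts k d t)"
  using assms(2)
proof (induction t arbitrary: us)
  case (Suc t)
  show ?case
  proof (cases us)
    case (Cons c vs)
    then show ?thesis
      using Suc assms(3) norep_map[OF assms(1) Suc.prems, of vs "excesses d 3 0"]
      by (auto simp: in_contexts_Suc)
  qed (simp add: in_contexts_Suc)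
qed simp

section \<open>Labelled windows and their recognition\<close>

fun windows :: "nat \<Rightarrow> nat \<Rightarrow> nat \<Rightarrow> 'a list \<Rightarrow> ('a list \<times> nat) list" where
  "windows 0 w l xs = []"
| "windows (Suc n) w l xs = (take w xs, l) # windows n w (Suc l) (tl xs)"

lemma in_windows: "y < n \<Longrightarrow> (take w (drop y xs), l + y) \<in> set (windows n w l xs)"
proof (induction n w l xs arbitrary: y rule: windows.induct)
  case (2 n w l xs)
  show ?case
  proof (cases y)
    case (Suc z)
    then have "(take w (drop z (tl xs)), Suc l + z) \<in> set (windows n w (Suc l) (tl xs))"
      using 2 by simp
    then show ?thesis using Suc by (simp add: drop_Suc)
  qed simp
qed simp

definition same_label :: "('a \<times> nat) list \<Rightarrow> bool" where
  "same_label ws = (case ws of [] \<Rightarrow> True | (_, l) # ws' \<Rightarrow> list_all (\<lambda>(_, l'). l' = l) ws')"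

lemma same_labelD: "same_label ws \<Longrightarrow> (v, l) \<in> set ws \<Longrightarrow> (v', l') \<in> set ws \<Longrightarrow> l = l'"
  by (cases ws) (auto simp: same_label_def list_all_iff, metis case_prodD)

text \<open>A decision tree: the words are grouped letter by letter until all labels in a group
  agree. This avoids comparing all pairs of windows when the check is executed.\<close>

fun separated :: "nat \<Rightarrow> nat \<Rightarrow> (nat list \<times> nat) list \<Rightarrow> bool" where
  "separated k 0 ws = same_label ws"
| "separated k (Suc n) ws = (same_label ws \<or>
     list_all (\<lambda>c. separated k n (map (\<lambda>(v, l). (tl v, l)) (filter (\<lambda>(v, l). hd v = c) ws))) [0..<k])"

lemma separatedD:
  assumes "separated k n ws" "(v, l) \<in> set ws" "(v, l') \<in> set ws" "n \<le> length v" "set v \<subseteq> {..<k}"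
  shows "l = l'"
  using assms
proof (induction n arbitrary: ws v)
  case 0
  then show ?case by (auto dest: same_labelD)
next
  case (Suc n)
  show ?case
  proof (cases "same_label ws")
    case True
    then show ?thesis using Suc.prems by (blast dest: same_labelD)
  next
    case False
    obtain c v' where v: "v = c # v'" using Suc.prems by (cases v) auto
    let ?ws = "map (\<lambda>(v, l). (tl v, l)) (filter (\<lambda>(v, l). hd v = c) ws)"
    have "separated k n ?ws" using Suc.prems False v by (simp add: list_all_iff)
    moreover have "(v', l) \<in> set ?ws" "(v', l') \<in> set ?ws"
      using Suc.prems v by (force simp: image_iff)+
    ultimately show ?thesis by (rule Suc.IH) (use Suc.prems v in auto)
  qed
qed

section \<open>Insertion and substitution on lists\<close>

definition splice_list :: "nat \<Rightarrow> 'a list \<Rightarrow> 'a list \<Rightarrow> 'a list" where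
  "splice_list i ys xs = take i xs @ ys @ drop i xs"

lemma length_splice_list [simp]: "length (splice_list i ys xs) = length xs + length ys"
  by (simp add: splice_list_def)

lemma nth_splice_list:
  assumes "i \<le> length xs" "y < length xs + length ys"
  shows "splice_list i ys xs ! y =
    (if y < i then xs ! y else if y < i + length ys then ys ! (y - i) else xs ! (y - length ys))"
  using assms by (auto simp: splice_list_def nth_append algebra_simps)

type_synonym frame_family = "nat \<Rightarrow> nat \<Rightarrow> nat \<Rightarrow> nat"

text \<open>Each letter is read together with its successor, so the last letter produces no block of
  its own and only completes the frame of the block before it.\<close>

fun blocks :: "frame_family \<Rightarrow> nat list \<Rightarrow> nat list \<Rightarrow> nat list" where
  "blocks f G (a # b # us) = map (f a b) G @ blocks f G (b # us)"
| "blocks f G us = []"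

lemma length_blocks [simp]: "length (blocks f G us) = length G * (length us - 1)"
  by (induction f G us rule: blocks.induct) auto

lemma nth_blocks:
  "y < length G * (length us - 1) \<Longrightarrow>
   blocks f G us ! y = f (us ! (y div length G)) (us ! Suc (y div length G)) (G ! (y mod length G))"
proof (induction f G us arbitrary: y rule: blocks.induct)
  case (1 f G a b us)
  have G: "length G > 0" using 1 by (cases G) auto
  show ?case
  proof (cases "y < length G")
    case False
    then have "y div length G = Suc ((y - length G) div length G)" "y mod length G = (y - length G) mod length G"
      using G by (simp_all add: le_div_geq le_mod_geq)
    then show ?thesis using 1 False by (simp add: nth_append)
  qed (use 1 in \<open>simp add: nth_append\<close>)
qed auto

text \<open>Substitution commutes with renaming by an element of the group. This is what allows the
  finite checks to run only over contexts with a prescribed frame 0, 1.\<close>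

lemma blocks_cong_map:
  assumes "\<And>x y z. x \<in> set us \<Longrightarrow> y \<in> set us \<Longrightarrow> z \<in> set G \<Longrightarrow> x \<noteq> y \<Longrightarrow> f (\<sigma> x) (\<sigma> y) z = \<sigma> (f x y z)"
    and "\<And>i. Suc i < length us \<Longrightarrow> us ! i \<noteq> us ! Suc i"
  shows "blocks f G (map \<sigma> us) = map \<sigma> (blocks f G us)"
  using assms
proof (induction f G us rule: blocks.induct)
  case (1 f G a b us)
  have "blocks f G (map \<sigma> (b # us)) = map \<sigma> (blocks f G (b # us))"
  proof (rule "1.IH")
    fix i assume "Suc i < length (b # us)"
    then show "(b # us) ! i \<noteq> (b # us) ! Suc i" using "1.prems"(2)[of "Suc i"] by simp
  qed (simp add: "1.prems"(1))
  moreover have "a \<noteq> b" using "1.prems"(2)[of 0] by simp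
  ultimately show ?case using "1.prems"(1)[of a b] by simp
qed auto

lemma nth_less: "set us \<subseteq> {..<k} \<Longrightarrow> i < length us \<Longrightarrow> us ! i < k"
  using nth_mem by fastforce

lemma contexts_adjacent:
  assumes "us \<in> set (contexts k d t)" "2 \<le> d" "Suc i < length us"
  shows "us ! i \<noteq> us ! Suc i"
  using assms(1,3)
proof (induction t arbitrary: us i)
  case (Suc t)
  then obtain c vs where us: "us = c # vs" "vs \<in> set (contexts k d t)" "norep (excesses d 3 0) us vs"
    by (auto simp: in_contexts_Suc)
  show ?case
  proof (cases i)
    case 0
    have "excesses d 3 0 ! 0 = 1" using assms(2) by (simp add: nth_excesses)
    then have "\<not> agree 1 us (drop 0 vs)" using us(3) unfolding norep_iff by force
    then show ?thesis using us(1) Suc.prems 0 by (cases vs) (auto simp: agree_iff)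
  next
    case (Suc j)
    then show ?thesis using us Suc.prems Suc.IH[of vs j] by simp
  qed
qed simp

text \<open>The contexts over-approximate the factors of good words: only the periods 1 and 2 are
  excluded, and both are smaller than \<open>m\<close>. Since contexts grow at the front, only
  repetitions starting at the new letter have to be ruled out.\<close>

lemma good_contexts:
  assumes "good d m u" "4 \<le> m" "\<And>x. u x < k"
  shows "map u [x..<x + t] \<in> set (contexts k d t)"
proof (induction t arbitrary: x)
  case (Suc t)
  have eq: "map u [x..<x + Suc t] = u x # map u [Suc x..<Suc x + t]" (is "?us = _ # ?vs")
    by (simp add: upt_conv_Cons del: upt_Suc)
  have "norep (excesses d 3 0) ?us ?vs"
    unfolding norep_iff
  proof (intro allI impI notI)
    fix p assume p: "p < length (excesses d 3 0)" and ag: "agree (excesses d 3 0 ! p) ?us (drop p ?vs)"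
    have e: "excesses d 3 0 ! p = Suc p div d + 1" using p by (simp add: nth_excesses)
    obtain i where i: "i \<le> Suc p div d" "u (x + i) \<noteq> u (x + Suc p + i)"
      using good_mismatch[OF assms(1), of "Suc p" x] p assms(2) by auto
    from i(1) have "i < excesses d 3 0 ! p" using e by simp
    then have "?us ! i = drop p ?vs ! i" "i < Suc t" "p + i < t"
      using ag unfolding agree_iff by (auto simp del: upt_Suc)
    moreover from this have "?us ! i = u (x + i)" "drop p ?vs ! i = u (x + Suc p + i)"
      by (auto simp del: upt_Suc simp: add.assoc)
    ultimately show False using i(2) by simp
  qed
  then show ?case using Suc.IH[of "Suc x"] assms(3) unfolding eq in_contexts_Suc by blast
qed simp

section \<open>Substitution and insertion\<close>

lemma nth_take_drop_drop:
  "i < l \<Longrightarrow> a + b + l \<le> length xs \<Longrightarrow> take l (drop b (drop a xs)) ! i = xs ! (a + b + i)"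
  by (simp add: ac_simps)

lemma mod_add_middle: "(a + b mod c + i) mod c = (a + b + i) mod (c :: nat)"
  by (metis mod_add_left_eq mod_add_right_eq)

text \<open>The maps f a b form a sharply 2-transitive group, indexed by the images a, b of 0, 1; the
  map g x y is the inverse of f x y.\<close>

definition frame_maps :: "nat \<Rightarrow> frame_family \<Rightarrow> frame_family \<Rightarrow> bool" where
  "frame_maps k f g \<longleftrightarrow> (\<forall>a<k. \<forall>b<k. a \<noteq> b \<longrightarrow>
     f a b 0 = a \<and> f a b 1 = b \<and> (\<forall>z<k. f a b z < k \<and> g a b z < k) \<and> inj_on (g a b) {..<k} \<and>
     (\<forall>x<k. \<forall>y<k. x \<noteq> y \<longrightarrow> (\<forall>z<k. f (f a b x) (f a b y) z = f a b (f x y z) \<and>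
        g (f a b x) (f a b y) (f a b z) = g x y z)))"

text \<open>Factors with the same normal form are the images of each other under the group.\<close>

definition canon :: "frame_family \<Rightarrow> nat list \<Rightarrow> nat list" where
  "canon g v = map (g (v ! 0) (v ! 1)) v"

text \<open>The label is the offset of the window in its block. Three letters give two blocks, which
  leaves room for a window running into the next block.\<close>

definition block_windows ::
  "nat \<Rightarrow> nat \<Rightarrow> nat \<Rightarrow> frame_family \<Rightarrow> frame_family \<Rightarrow> nat list \<Rightarrow> (nat list \<times> nat) list"
  where "block_windows k d w f g G =
    concat (map (\<lambda>us. map (\<lambda>(v, l). (canon g v, l)) (windows (length G) w 0 (blocks f G us)))
      (filter (\<lambda>us. us ! 0 = 0 \<and> us ! 1 = 1) (contexts k d 3)))"

text \<open>These are the windows that meet \<open>ys\<close>: the first one ends at its first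
  letter, the last one starts at its last letter. They are not normalised, because the word
  \<open>u\<close> will be relabelled so that the split block has frame 0, 1.\<close>

definition insert_windows ::
  "nat \<Rightarrow> nat \<Rightarrow> nat \<Rightarrow> nat \<Rightarrow> frame_family \<Rightarrow> nat list \<Rightarrow> nat list \<Rightarrow> (nat list \<times> nat) list"
  where "insert_windows k d w \<kappa> f G ys =
    concat (map (\<lambda>us. windows (length ys + w - 1) w 0 (drop (\<kappa> - (w - 1)) (splice_list \<kappa> ys (blocks f G us))))
      (filter (\<lambda>us. us ! 0 = 0 \<and> us ! 1 = 1) (contexts k d 3)))"

text \<open>From the period \<open>d * (w - 1)\<close> on, a repetition repeats a full window of
  length \<open>w\<close> and is left to \<open>window_check\<close>; below it, everything is
  checked directly. The period \<open>length G\<close> is exempt because aligned blocks are treated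
  by comparing frames.\<close>

definition block_check ::
  "nat \<Rightarrow> nat \<Rightarrow> nat \<Rightarrow> frame_family \<Rightarrow> nat list \<Rightarrow> bool"
  where "block_check k d w f G \<longleftrightarrow>
    list_all (\<lambda>us. norep_upto (length G) (excesses d (d * (w - 1)) (length G)) (blocks f G us))
      (filter (\<lambda>us. us ! 0 = 0 \<and> us ! 1 = 1) (contexts k d 4))"

text \<open>No offset in a block equals \<open>length G\<close>, so the first condition also says
  that a window meeting the insertion is never the image of a window of pure blocks. The second
  condition locates the windows meeting the insertion relative to each other.\<close>

definition window_check ::
  "nat \<Rightarrow> nat \<Rightarrow> nat \<Rightarrow> nat \<Rightarrow> frame_family \<Rightarrow> frame_family \<Rightarrow> nat list \<Rightarrow> nat list \<Rightarrow> bool"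
  where "window_check k d w \<kappa> f g G ys \<longleftrightarrow>
    separated k w (block_windows k d w f g G @
      map (\<lambda>(v, _). (canon g v, length G)) (insert_windows k d w \<kappa> f G ys)) \<and>
    separated k w (insert_windows k d w \<kappa> f G ys)"

text \<open>The three lists treat the repetitions that start after the beginning of the split block, in the
  block before it, and in the second block before it.\<close>

definition insert_check ::
  "nat \<Rightarrow> nat \<Rightarrow> nat \<Rightarrow> nat \<Rightarrow> frame_family \<Rightarrow> nat list \<Rightarrow> nat list \<Rightarrow> bool"
  where "insert_check k d w \<kappa> f G ys \<longleftrightarrow> (let E = excesses d (d * (w - 1)) 0 in
    list_all (\<lambda>us. norep_upto (\<kappa> + length ys) E (splice_list \<kappa> ys (blocks f G us)))
      (filter (\<lambda>us. us ! 0 = 0 \<and> us ! 1 = 1) (contexts k d 4)) \<and>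
    list_all (\<lambda>us. norep_upto (length G) E (splice_list (length G + \<kappa>) ys (blocks f G us)))
      (filter (\<lambda>us. us ! 1 = 0 \<and> us ! 2 = 1) (contexts k d 4)) \<and>
    list_all (\<lambda>us. norep_upto (length G - \<kappa>) E (drop \<kappa> (splice_list (2 * length G + \<kappa>) ys (blocks f G us))))
      (filter (\<lambda>us. us ! 2 = 0 \<and> us ! 3 = 1) (contexts k d 4)))"

text \<open>The bound on \<open>(d + 1) * (w - 1)\<close> keeps repetitions of small period within
  two blocks' length; \<open>2 * d\<close> \<le> \<open>length G\<close> makes a match between
  aligned blocks long enough to determine a frame; \<open>w - 1\<close> \<le> \<kappa> keeps windows
  that meet \<open>ys\<close> from starting before the split block; the bound on
  \<open>length ys\<close> puts half of the new length below \<open>length G * m\<close>.\<close>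

locale substitution =
  fixes k d w \<kappa> :: nat and f g :: frame_family and G ys :: "nat list"
  assumes d: "2 \<le> d" "2 * d \<le> length G"
    and w: "2 \<le> w" "(d + 1) * (w - 1) \<le> 2 * length G" "w - 1 \<le> \<kappa>" "\<kappa> \<le> length G"
    and k: "2 \<le> k" "set G \<subseteq> {..<k}" "set ys \<subseteq> {..<k}" "length ys < 4 * length G"
    and frame_maps: "frame_maps k f g"
    and step: "\<And>i. Suc i < length G \<Longrightarrow> G ! i \<noteq> G ! Suc i"
    and block_check: "block_check k d w f G"
    and window_check: "window_check k d w \<kappa> f g G ys"
    and insert_check: "insert_check k d w \<kappa> f G ys"
begin

abbreviation "L \<equiv> length G"

section \<open>Sharp 2-transitivity of the frame maps\<close>

lemma f_less: "a < k \<Longrightarrow> b < k \<Longrightarrow> a \<noteq> b \<Longrightarrow> z < k \<Longrightarrow> f a b z < k"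
  and g_less: "a < k \<Longrightarrow> b < k \<Longrightarrow> a \<noteq> b \<Longrightarrow> z < k \<Longrightarrow> g a b z < k"
  and f_0: "a < k \<Longrightarrow> b < k \<Longrightarrow> a \<noteq> b \<Longrightarrow> f a b 0 = a"
  and f_1: "a < k \<Longrightarrow> b < k \<Longrightarrow> a \<noteq> b \<Longrightarrow> f a b 1 = b"
  and g_inj: "a < k \<Longrightarrow> b < k \<Longrightarrow> a \<noteq> b \<Longrightarrow> inj_on (g a b) {..<k}"
  and f_equivariant: "a < k \<Longrightarrow> b < k \<Longrightarrow> a \<noteq> b \<Longrightarrow> x < k \<Longrightarrow> y < k \<Longrightarrow> x \<noteq> y \<Longrightarrow> z < k \<Longrightarrow>
    f (f a b x) (f a b y) z = f a b (f x y z)"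
  and g_invariant: "a < k \<Longrightarrow> b < k \<Longrightarrow> a \<noteq> b \<Longrightarrow> x < k \<Longrightarrow> y < k \<Longrightarrow> x \<noteq> y \<Longrightarrow> z < k \<Longrightarrow>
    g (f a b x) (f a b y) (f a b z) = g x y z"
  using frame_maps unfolding frame_maps_def by blast+

text \<open>Invariance of \<open>g\<close> at the frame 0, 1 recovers \<open>g 0 1 x\<close> from
  \<open>f a b x\<close>, and \<open>g 0 1\<close> is injective.\<close>

lemma f_inj: "a < k \<Longrightarrow> b < k \<Longrightarrow> a \<noteq> b \<Longrightarrow> inj_on (f a b) {..<k}"
proof (rule inj_onI)
  fix x y assume *: "a < k" "b < k" "a \<noteq> b" "x \<in> {..<k}" "y \<in> {..<k}" "f a b x = f a b y"
  then have "g 0 1 x = g 0 1 y"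
    using k(1) g_invariant[of a b 0 1 x] g_invariant[of a b 0 1 y] by simp
  then show "x = y" using g_inj[of 0 1] k(1) * by (simp add: inj_on_def)
qed

lemma f_surj:
  assumes "a < k" "b < k" "a \<noteq> b"
  shows "f a b ` {..<k} = {..<k}"
  using f_inj[OF assms] f_less[OF assms] by (intro endo_inj_surj) auto

text \<open>The two common values form a frame themselves. Applying \<open>g\<close> for that frame
  to \<open>f a b z\<close> or to \<open>f a' b' z\<close> gives \<open>g x y z\<close> in both
  cases, so the two maps coincide everywhere.\<close>

lemma f_determined:
  assumes "a < k" "b < k" "a \<noteq> b" "a' < k" "b' < k" "a' \<noteq> b'" "x < k" "y < k" "x \<noteq> y"
    and eq: "f a b x = f a' b' x" "f a b y = f a' b' y"
  shows "a = a' \<and> b = b'"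
proof -
  let ?v = "f a b x" and ?v' = "f a b y"
  have v: "?v < k" "?v' < k" "?v \<noteq> ?v'"
    using f_less f_inj[of a b] assms by (auto simp: inj_on_def)
  have "f a b z = f a' b' z" if "z < k" for z
  proof -
    have "g ?v ?v' (f a b z) = g ?v ?v' (f a' b' z)"
      using assms that g_invariant[of a b x y z] g_invariant[of a' b' x y z] by simp
    then show ?thesis using g_inj[OF v] f_less assms that by (simp add: inj_on_def)
  qed
  from this[of 0] this[of 1] show ?thesis using assms f_0 f_1 k(1) by auto
qed

text \<open>The first two letters of a context are distinct and hence form a frame. Pulling the
  context back along the corresponding bijection normalises it to start with 0, 1, and the
  substitution follows by equivariance.\<close>

lemma context_frame:
  assumes us: "us \<in> set (contexts k d t)" and t: "2 \<le> t"
  obtains a b us' where "a < k" "b < k" "a \<noteq> b" "us' \<in> set (contexts k d t)" "us' ! 0 = 0" "us' ! 1 = 1"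
    "blocks f G us = map (f a b) (blocks f G us')" "us = map (f a b) us'"
proof -
  let ?a = "us ! 0" and ?b = "us ! 1"
  have us': "set us \<subseteq> {..<k}" "length us = t" using contexts_subset[OF us] by auto
  have ab: "?a < k" "?b < k" using us' t by (simp_all add: nth_less)
  have ne: "?a \<noteq> ?b" using contexts_adjacent[OF us d(1), of 0] us'(2) t by simp
  note fr = ab ne
  let ?inv = "inv_into {..<k} (f ?a ?b)"
  define vs where "vs = map ?inv us"
  have vs: "map (f ?a ?b) vs = us"
    unfolding vs_def map_map
  proof (rule map_idI)
    fix x assume "x \<in> set us"
    then have "x \<in> f ?a ?b ` {..<k}" using us'(1) f_surj[OF fr] by auto
    then show "(f ?a ?b \<circ> ?inv) x = x" by (simp add: f_inv_into_f)
  qed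
  have vsk: "set vs \<subseteq> {..<k}"
  proof
    fix z assume "z \<in> set vs"
    then obtain x where x: "x \<in> set us" "z = ?inv x" unfolding vs_def by auto
    then have "x \<in> f ?a ?b ` {..<k}" using us'(1) f_surj[OF fr] by auto
    then show "z \<in> {..<k}" unfolding x(2) by (rule inv_into_into)
  qed
  have vsc: "vs \<in> set (contexts k d t)"
    using in_contexts_map[OF f_inj[OF fr] vsk] f_less[OF fr] us vs by auto
  have len: "length vs = t" using us'(2) by (simp add: vs_def)
  have nth: "f ?a ?b (vs ! i) = us ! i" "vs ! i < k" if "i < t" for i
  proof -
    show "f ?a ?b (vs ! i) = us ! i" using nth_map[of i vs "f ?a ?b"] that len unfolding vs by simp
    show "vs ! i < k" using nth_less[OF vsk] that len by simp
  qed
  have v0: "vs ! 0 = 0"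
    using inj_onD[OF f_inj[OF fr], of "vs ! 0" 0] nth[of 0] f_0[OF fr] t k(1) by simp
  have v1: "vs ! 1 = 1"
    using inj_onD[OF f_inj[OF fr], of "vs ! 1" 1] nth[of 1] f_1[OF fr] t k(1) by simp
  have "blocks f G (map (f ?a ?b) vs) = map (f ?a ?b) (blocks f G vs)"
  proof (rule blocks_cong_map)
    show "f (f ?a ?b x) (f ?a ?b y) z = f ?a ?b (f x y z)"
      if "x \<in> set vs" "y \<in> set vs" "z \<in> set G" "x \<noteq> y" for x y z
      using that vsk k(2) by (intro f_equivariant[OF fr]) auto
  qed (rule contexts_adjacent[OF vsc d(1)])
  then show thesis using that[OF fr vsc v0 v1] vs by simp
qed

lemma blocks_less:
  assumes "us \<in> set (contexts k d t)"
  shows "set (blocks f G us) \<subseteq> {..<k}"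
proof
  fix z assume "z \<in> set (blocks f G us)"
  then obtain y where y: "y < L * (length us - 1)" "z = blocks f G us ! y"
    by (auto simp: in_set_conv_nth)
  have G: "0 < L" using d by linarith
  let ?j = "y div L"
  have "?j < length us - 1" using y(1) by (intro less_mult_imp_div_less) (simp add: mult.commute)
  then have j: "Suc ?j < length us" by simp
  have "us ! ?j < k" "us ! Suc ?j < k"
    using contexts_subset[OF assms] j by (simp_all add: nth_less)
  moreover have "G ! (y mod L) < k" using k(2) G by (simp add: nth_less)
  ultimately show "z \<in> {..<k}"
    using y contexts_adjacent[OF assms d(1) j] nth_blocks[OF y(1)] f_less by simp
qed

end

section \<open>Repetitions in the substituted word\<close>

locale substituted = substitution +
  fixes m :: nat and u :: "nat \<Rightarrow> nat"
  assumes good_u: "good d m u" and m: "4 \<le> m" and u_less: "u x < k" and u01: "u 0 = 0" "u 1 = 1"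
begin

definition v :: "nat \<Rightarrow> nat" where
  "v x = f (u (x div L)) (u (Suc (x div L))) (G ! (x mod L))"

lemma L_pos: "0 < L"
  using d by linarith

lemma u_contexts: "map u [j..<j + t] \<in> set (contexts k d t)"
  by (rule good_contexts[OF good_u m u_less])

lemma u_adjacent: "u x \<noteq> u (Suc x)"
  using contexts_adjacent[OF u_contexts[of x 2] d(1), of 0] by simp

lemma u_periodic: "u (x + m) = u x"
  using good_u by (simp add: good_def)

lemma v_less: "v x < k"
  unfolding v_def using f_less u_less u_adjacent nth_less[OF k(2)] L_pos by simp

lemma v_periodic: "v (x + L * m) = v x"
proof -
  have "(x + L * m) div L = x div L + m" "(x + L * m) mod L = x mod L"
    using L_pos by (simp_all add: add.commute)
  then show ?thesis using u_periodic[of "x div L"] u_periodic[of "Suc (x div L)"] by (simp add: v_def)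
qed

lemma v_blocks:
  assumes "y < L * t"
  shows "blocks f G (map u [j..<j + Suc t]) ! y = v (L * j + y)"
proof -
  have yt: "y div L < t" using assms by (intro less_mult_imp_div_less) (simp add: mult.commute)
  have "(L * j + y) div L = j + y div L" "(L * j + y) mod L = y mod L" using L_pos by simp_all
  moreover have "map u [j..<j + Suc t] ! (y div L) = u (j + y div L)"
    "map u [j..<j + Suc t] ! Suc (y div L) = u (j + Suc (y div L))"
    using yt by (simp_all del: upt_Suc)
  ultimately show ?thesis
    using assms by (subst nth_blocks) (simp_all add: v_def del: upt_Suc)
qed

abbreviation "P \<equiv> d * (w - 1)"

text \<open>A repetition of period below \<open>P\<close> that starts in the first of three blocks
  therefore ends within them; hence contexts of four letters in the checks.\<close>

lemma span: "p < P \<Longrightarrow> p + p div d < 2 * L"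
proof -
  assume p: "p < P"
  then have "p div d < w - 1" by (intro less_mult_imp_div_less) (simp add: mult.commute)
  then have "p + p div d < P + (w - 1)" using p by linarith
  also have "\<dots> = (d + 1) * (w - 1)" by (simp only: add_mult_distrib mult_1)
  finally show ?thesis using w(2) by linarith
qed

text \<open>The injective map \<open>f a b\<close> carries the mismatch found in the normalised
  context over to the actual one.\<close>

lemma v_small:
  assumes "1 \<le> p" "p < P" "p \<noteq> L"
  shows "\<exists>i\<le>p div d. v (x + i) \<noteq> v (x + p + i)"
proof -
  let ?j = "x div L" and ?o = "x mod L"
  have x: "x = L * ?j + ?o" by simp
  obtain a b us' where *: "a < k" "b < k" "a \<noteq> b" "us' \<in> set (contexts k d 4)" "us' ! 0 = 0" "us' ! 1 = 1"
    "blocks f G (map u [?j..<?j + 4]) = map (f a b) (blocks f G us')"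
    by (rule context_frame[OF u_contexts[of ?j 4]]) auto
  let ?bs = "blocks f G us'"
  have len: "length ?bs = 3 * L" using contexts_subset[OF *(4)] by simp
  have o: "?o < L" using L_pos by simp
  have ran: "?o + p + p div d < 3 * L" using span[OF assms(2)] o by linarith
  have chk: "norep_upto L (excesses d P L) ?bs"
    using block_check *(4-6) unfolding block_check_def list_all_iff by auto
  obtain i where i: "i \<le> p div d" "?bs ! (?o + i) \<noteq> ?bs ! (?o + p + i)"
    using norep_uptoD[OF chk o assms] ran len by auto
  have val: "v (L * ?j + y) = f a b (?bs ! y)" and less: "?bs ! y < k" if "y < 3 * L" for y
  proof -
    have "blocks f G (map u [?j..<?j + Suc 3]) ! y = v (L * ?j + y)"
      by (rule v_blocks) (use that in \<open>simp add: mult.commute\<close>)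
    then have "map (f a b) ?bs ! y = v (L * ?j + y)" using *(7) by simp
    moreover have yl: "y < length ?bs" using that by (simp only: len)
    ultimately show "v (L * ?j + y) = f a b (?bs ! y)" by simp
    show "?bs ! y < k" using blocks_less[OF *(4)] yl by (rule nth_less)
  qed
  have "f a b (?bs ! (?o + i)) \<noteq> f a b (?bs ! (?o + p + i))"
    using i ran less inj_on_eq_iff[OF f_inj[OF *(1-3)]] by simp
  moreover have "v (L * ?j + (?o + i)) = f a b (?bs ! (?o + i))"
    by (rule val) (use i(1) ran in linarith)
  moreover have "v (L * ?j + (?o + p + i)) = f a b (?bs ! (?o + p + i))"
    by (rule val) (use i(1) ran in linarith)
  ultimately have "v (L * ?j + (?o + i)) \<noteq> v (L * ?j + (?o + p + i))" by (simp only: not_False_eq_True)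
  moreover have "L * ?j + (?o + i) = x + i" "L * ?j + (?o + p + i) = x + p + i" using x by linarith+
  ultimately show ?thesis using i(1) by metis
qed

text \<open>A match of two consecutive letters of aligned blocks forces equal frames; the frame of block j
  consists of the letters j and j + 1 of u.\<close>

lemma v_aligned:
  assumes q: "1 \<le> q" "q < m"
  shows "\<exists>i\<le>(L * q) div d. v (x + i) \<noteq> v (x + L * q + i)"
proof (rule ccontr)
  assume "\<not> ?thesis"
  then have eq: "v (x + i) = v (x + L * q + i)" if "i \<le> (L * q) div d" for i using that by blast
  \<comment> \<open>The first block with two consecutive letters at or after \<open>x\<close>: if
    \<open>x\<close> is the last position of its block, this is the next block.\<close>
  define j where "j = (x + 1) div L"
  have frame: "u (j + s) = u (j + q + s) \<and> u (Suc (j + s)) = u (Suc (j + q + s))"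
    if s: "L * s + 2 \<le> (L * q) div d" for s
  proof -
    \<comment> \<open>The first position of block \<open>j + s\<close> that is not before
      \<open>x\<close>. Block \<open>j\<close> may start as late as \<open>x + 1\<close>, so
      reaching two letters of block \<open>j + s\<close> takes \<open>L * s + 2\<close> steps at
      most.\<close>
    define y where "y = max x (L * (j + s))"
    have jl: "L * j \<le> x + 1" "x + 1 < L * j + L"
      unfolding j_def using times_div_less_eq_dividend dividend_less_times_div[OF L_pos, of "x + 1"]
      by simp_all
    have y: "L * (j + s) \<le> y" "y + 1 < L * (j + s) + L" "x \<le> y" "y + 1 \<le> x + (L * q) div d"
      using jl s d unfolding y_def by (simp_all only: distrib_left max_def split: if_splits) linarith+
    obtain o' where o': "y = L * (j + s) + o'" using y(1) le_iff_add by blast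
    have oL: "Suc o' < L" using y(2) o' by simp
    have div: "(y + e) div L = j + s" "(y + L * q + e) div L = j + q + s"
      "(y + e) mod L = o' + e" "(y + L * q + e) mod L = o' + e" if "e \<le> 1" for e
    proof -
      have eqs: "y + e = (o' + e) + L * (j + s)" "y + L * q + e = (o' + e) + L * (j + q + s)"
        using o' by (simp_all add: distrib_left)
      have "o' + e < L" using oL that by linarith
      then show "(y + e) div L = j + s" "(y + L * q + e) div L = j + q + s"
        "(y + e) mod L = o' + e" "(y + L * q + e) mod L = o' + e"
        unfolding eqs using L_pos by simp_all
    qed
    have vv: "v (y + e) = v (y + L * q + e)" if "e \<le> 1" for e
      using eq[of "y - x + e"] y(3,4) that by (simp add: algebra_simps)
    have eqf: "f (u (j + s)) (u (Suc (j + s))) (G ! (o' + e)) =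
        f (u (j + q + s)) (u (Suc (j + q + s))) (G ! (o' + e))" if "e \<le> 1" for e
      using vv[OF that] by (simp only: v_def div[OF that])
    have G: "G ! o' < k" "G ! Suc o' < k" using nth_less[OF k(2)] oL by simp_all
    show ?thesis
      by (rule f_determined[OF u_less u_less u_adjacent u_less u_less u_adjacent G step[OF oL]])
        (use eqf[of 0] eqf[of 1] in simp_all)
  qed
  have main: "u (j + i) = u (j + q + i)" if i: "i \<le> q div d" for i
  proof -
    \<comment> \<open>The letter \<open>j + i\<close> is the second letter of the frame of block
      \<open>j + i - 1\<close>, which needs one block less of matching; for \<open>i = 0\<close> the
      subtraction stops at 0 and the first letter of the frame is used.\<close>
    define s where "s = i - 1"
    have "L * s + 2 \<le> (L * q) div d"
    proof (cases "q div d = 0")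
      case True
      have "L \<le> L * q" using q(1) by simp
      then have "2 * d \<le> L * q" using d(2) by linarith
      then have "2 \<le> (L * q) div d" using div_le_mono[of "2 * d" "L * q" d] d(1) by simp
      then show ?thesis using True i s_def by simp
    next
      case False
      have "s + 1 \<le> q div d" using False i s_def by linarith
      then have "L * (s + 1) \<le> L * (q div d)" by (rule mult_le_mono2)
      also have "\<dots> \<le> (L * q) div d" using div_mult1_eq[of L q d] by simp
      finally show ?thesis using d by simp
    qed
    from frame[OF this] have *: "u (j + s) = u (j + q + s)" "u (Suc (j + s)) = u (Suc (j + q + s))"
      by blast+
    show ?thesis
    proof (cases i)
      case 0
      then show ?thesis using *(1) by (simp only: s_def diff_0_eq_0 diff_Suc_1)
    next
      case (Suc i')
      then show ?thesis using *(2) by (simp only: s_def diff_Suc_1 add_Suc_right)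
    qed
  qed
  obtain i where "i \<le> q div d" "u (j + i) \<noteq> u (j + q + i)"
    using good_mismatch[OF good_u q] by blast
  then show False using main by blast
qed

lemma P_ge: "2 \<le> P"
  using d(1) w(1) mult_le_mono[of 2 d 1 "w - 1"] by simp

lemma v_adjacent: "v x \<noteq> v (Suc x)"
  using v_small[of 1 x] P_ge d by auto

text \<open>The actual window is the image of a window of a normalised context under some
  \<open>f a b\<close>, and \<open>canon\<close> cancels this map by invariance of \<open>g\<close>.
  Adjacent letters are distinct, so the first two letters of the window are a valid frame.\<close>

lemma block_window:
  "(canon g (map (\<lambda>i. v (x + i)) [0..<w]), x mod L) \<in> set (block_windows k d w f g G)"
proof -
  let ?j = "x div L" and ?o = "x mod L"
  have x: "x = L * ?j + ?o" by simp
  obtain a b us' where *: "a < k" "b < k" "a \<noteq> b" "us' \<in> set (contexts k d 3)" "us' ! 0 = 0" "us' ! 1 = 1"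
    "blocks f G (map u [?j..<?j + 3]) = map (f a b) (blocks f G us')"
    by (rule context_frame[OF u_contexts[of ?j 3]]) auto
  let ?bs = "blocks f G us'"
  let ?t = "take w (drop ?o ?bs)" and ?win = "map (\<lambda>i. v (x + i)) [0..<w]"
  have len: "length ?bs = L * 2" using contexts_subset[OF *(4)] by simp
  have o: "?o < L" using L_pos by simp
  have ow: "?o + w \<le> L * 2" using o w by linarith
  have win: "?win = map (f a b) ?t"
  proof (rule nth_equalityI)
    show "length ?win = length (map (f a b) ?t)" using ow by (simp add: len del: length_blocks)
    fix i assume "i < length ?win"
    then have i: "i < w" by simp
    then have oi: "?o + i < L * 2" using ow by linarith
    have "map (f a b) ?bs ! (?o + i) = v (L * ?j + (?o + i))"
      using v_blocks[OF oi, of ?j] *(7) by (simp add: eval_nat_numeral del: upt_Suc)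
    then show "?win ! i = map (f a b) ?t ! i"
      using i oi by (simp add: len x[symmetric] add.assoc[symmetric] del: length_blocks)
  qed
  have lent: "length ?t = w" using ow by (simp add: len del: length_blocks)
  have tk: "set ?t \<subseteq> {..<k}" using blocks_less[OF *(4)] by (auto dest: in_set_takeD in_set_dropD)
  have "0 < length ?t" "1 < length ?t" using lent w(1) by linarith+
  then have t01: "?t ! 0 < k" "?t ! 1 < k" using nth_less[OF tk] by blast+
  have "?win ! 0 = v x" "?win ! 1 = v (Suc x)" using w(1) by simp_all
  moreover have "?win ! 0 = f a b (?t ! 0)" "?win ! 1 = f a b (?t ! 1)"
    unfolding win using lent w(1) by (auto intro!: nth_map)
  ultimately have ne: "?t ! 0 \<noteq> ?t ! 1" using v_adjacent[of x] by metis
  have "canon g (map (f a b) ?t) = canon g ?t"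
  proof -
    have "map (f a b) ?t ! 0 = f a b (?t ! 0)" "map (f a b) ?t ! 1 = f a b (?t ! 1)"
      using lent w(1) by (auto intro!: nth_map)
    then show ?thesis
      unfolding canon_def map_map comp_def
      using g_invariant[OF *(1-3) t01 ne] tk by (intro map_cong) auto
  qed
  then have "canon g ?win = canon g ?t" unfolding win .
  moreover have "(?t, ?o) \<in> set (windows L w 0 ?bs)" using in_windows[OF o, of w ?bs 0] by simp
  ultimately show ?thesis unfolding block_windows_def using *(4-6) by force
qed

section \<open>Inserting a word into the substituted word\<close>

abbreviation "r \<equiv> length ys"
abbreviation "n \<equiv> L * m + r"

lemma n_ge: "4 * L + r \<le> n"
  using m mult_le_mono2[of 4 m L] by simp

text \<open>W is the substituted word with ys inserted before position \<kappa>, rotated such that ys comes first.\<close>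

definition W :: "nat \<Rightarrow> nat" where
  "W x = (if x mod n < r then ys ! (x mod n) else v (x mod n - r + \<kappa>))"

lemma W_cong: "x mod n = y mod n \<Longrightarrow> W x = W y"
  by (simp add: W_def)

lemma W_less: "W x < k"
  using nth_less[OF k(3)] v_less by (simp add: W_def)

lemma W_stretch:
  assumes "r \<le> x" "x + i < n"
  shows "W (x + i) = v (x - r + \<kappa> + i)"
proof -
  have "x + i - r + \<kappa> = x - r + \<kappa> + i" using assms(1) by linarith
  then show ?thesis using assms by (simp add: W_def)
qed

text \<open>Multiples of \<open>L\<close> reduce to repetitions in \<open>u\<close>, and other
  periods below \<open>P\<close> are checked. For all remaining periods the repetition would contain
  the same window of length \<open>w\<close> at \<open>x\<close> and \<open>x + p\<close>; its
  normal form determines the offset modulo \<open>L\<close>, so \<open>L\<close> would divide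
  \<open>p\<close>.\<close>

lemma v_mismatch:
  assumes p: "1 \<le> p" "p < L * m"
  shows "\<exists>i\<le>p div d. v (x + i) \<noteq> v (x + p + i)"
proof (cases "L dvd p")
  case True
  then obtain q where "p = L * q" by blast
  then show ?thesis using v_aligned[of q x] p by simp
next
  case False
  show ?thesis
  proof (cases "p < P")
    case True
    then show ?thesis using v_small p False by fastforce
  next
    case pP: False
    show ?thesis
    proof (rule ccontr)
      assume no: "\<not> ?thesis"
      have "w - 1 \<le> p div d" using pP d(1) div_le_mono[of P p d] by simp
      then have eq: "v (x + i) = v (x + p + i)" if "i < w" for i using no that by auto
      have map_eq: "map (\<lambda>i. v (x + i)) [0..<w] = map (\<lambda>i. v (x + p + i)) [0..<w]"
        using eq by simp
      have win: "(canon g (map (\<lambda>i. v (x + i)) [0..<w]), (x + p) mod L) \<in> set (block_windows k d w f g G)"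
        unfolding map_eq by (rule block_window)
      let ?c = "canon g (map (\<lambda>i. v (x + i)) [0..<w])"
      have "set ?c \<subseteq> {..<k}"
        using g_less v_less v_adjacent w(1) unfolding canon_def by auto
      moreover have "w \<le> length ?c" by (simp add: canon_def)
      ultimately have "x mod L = (x + p) mod L"
        using window_check win block_window[of x] unfolding window_check_def
        by (elim conjE separatedD) auto
      then have "L dvd p" using mod_eq_dvd_iff_nat[of x "x + p" L] by simp
      then show False using False by blast
    qed
  qed
qed

text \<open>Around the insertion \<open>W\<close> is a context with \<open>ys\<close> spliced in:
  \<open>h\<close> whole blocks precede the split block, which has index \<open>m\<close>, that is,
  0 modulo the period of \<open>u\<close>. Positions past the end of the circle are brought back by
  the periodicity of \<open>v\<close>.\<close>

lemma W_context:
  assumes h: "h < t" "t \<le> 3" and y: "y < L * t + r"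
  shows "W (n - (h * L + \<kappa>) + y) =
    splice_list (h * L + \<kappa>) ys (blocks f G (map u [m - h..<m - h + Suc t])) ! y"
proof -
  let ?us = "map u [m - h..<m - h + Suc t]" and ?c = "h * L + \<kappa>"
  have len: "length (blocks f G ?us) = L * t" by simp
  have hL: "h * L + L \<le> L * t" using h mult_le_mono2[of "Suc h" t L] by (simp add: mult.commute)
  have tL: "L * t \<le> 3 * L" using h(2) by simp
  have c: "?c \<le> L * t" "?c + L \<le> L * m" using hL w(4) tL n_ge by linarith+
  have hm: "L * (m - h) = L * m - h * L" by (simp add: diff_mult_distrib2 mult.commute)
  have blk: "blocks f G ?us ! z = v (L * m - h * L + z)" if "z < L * t" for z
    using v_blocks[OF that, of "m - h"] hm by simp
  show ?thesis
  proof (cases "y < ?c")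
    case True
    then have "r \<le> n - ?c + y" "n - ?c + y < n" using c by linarith+
    then have "W (n - ?c + y) = v (n - ?c + y - r + \<kappa>)" using W_stretch[of "n - ?c + y" 0] by simp
    moreover have "n - ?c + y - r + \<kappa> = L * m - h * L + y" using c by linarith
    ultimately show ?thesis using True c y blk len by (simp add: nth_splice_list del: length_blocks)
  next
    case ge: False
    then have mod: "(n - ?c + y) mod n = (y - ?c) mod n"
    proof -
      have "n - ?c + y = y - ?c + n" using ge c by linarith
      then show ?thesis by (simp only: mod_add_self2)
    qed
    have yn: "y - ?c < n" using y tL n_ge by linarith
    show ?thesis
    proof (cases "y < ?c + r")
      case True
      then have "W (n - ?c + y) = ys ! (y - ?c)" using mod yn ge unfolding W_def by (simp add: less_diff_conv2)
      then show ?thesis using True ge c y len by (simp add: nth_splice_list del: length_blocks)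
    next
      case False
      then have "\<not> y - ?c < r" by linarith
      then have "W (n - ?c + y) = v (y - ?c - r + \<kappa>)" using mod yn by (simp add: W_def)
      also have "\<dots> = v (y - ?c - r + \<kappa> + L * m)" by (simp add: v_periodic)
      also have "y - ?c - r + \<kappa> + L * m = L * m - h * L + (y - r)" using False c by linarith
      also have "v \<dots> = blocks f G ?us ! (y - r)" using y False by (intro blk[symmetric]) linarith
      finally show ?thesis using False ge c y len by (simp add: nth_splice_list del: length_blocks)
    qed
  qed
qed

lemma W_mod: "W (x mod n + i) = W (x + i)"
  by (rule W_cong) (simp add: mod_simps)

lemma W_context_mismatch:
  assumes h: "h < 3" and i: "i \<le> p div d" and ran: "y + p + p div d < 3 * L + r"
    and ne: "splice_list (h * L + \<kappa>) ys (blocks f G (map u [m - h..<m - h + 4])) ! (y + i) \<noteq>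
      splice_list (h * L + \<kappa>) ys (blocks f G (map u [m - h..<m - h + 4])) ! (y + p + i)"
  shows "W (n - (h * L + \<kappa>) + y + i) \<noteq> W (n - (h * L + \<kappa>) + y + p + i)"
proof -
  have "Suc 3 = (4::nat)" by simp
  note W_context[OF h order_refl, unfolded this]
  from this[of "y + i"] this[of "y + p + i"] show ?thesis
    using ne i ran by (simp add: add.assoc mult.commute)
qed

text \<open>A repetition starting outside \<open>ys\<close> and not running past the end of the
  circle lies in \<open>v\<close>. Every other one is short by \<open>span\<close>, hence close to
  the insertion and covered by one of the three lists of \<open>insert_check\<close>.\<close>

lemma W_small:
  assumes p: "1 \<le> p" "p < P"
  shows "\<exists>i\<le>p div d. W (x + i) \<noteq> W (x + p + i)"
proof -
  define x0 where "x0 = x mod n"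
  have "n > 0" using n_ge L_pos by linarith
  then have x0: "x0 < n" by (simp add: x0_def)
  have sp: "p + p div d < 2 * L" by (rule span[OF p(2)])
  have via: "\<exists>i\<le>p div d. W (x + i) \<noteq> W (x + p + i)"
    if "z mod n = x0" "\<exists>i\<le>p div d. W (z + i) \<noteq> W (z + p + i)" for z
  proof -
    have "W (z + e) = W (x + e)" for e
      using W_mod[of z e] W_mod[of x e] that(1) by (simp add: x0_def)
    then show ?thesis using that(2) by (metis add.assoc)
  qed
  have u_m: "u m = 0" "u (Suc m) = 1"
    using u_periodic[of 0] u_periodic[of 1] u01 by simp_all
  have first: "\<exists>i\<le>p div d. W (n - \<kappa> + y + i) \<noteq> W (n - \<kappa> + y + p + i)" if y: "y < \<kappa> + r" for y
  proof -
    let ?us = "map u [m..<m + 4]"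
    have chk: "norep_upto (\<kappa> + r) (excesses d P 0) (splice_list \<kappa> ys (blocks f G ?us))"
      using insert_check u_contexts[of m 4] u_m unfolding insert_check_def Let_def list_all_iff
      by (simp del: upt_Suc)
    obtain i where i: "i \<le> p div d" "splice_list \<kappa> ys (blocks f G ?us) ! (y + i) \<noteq>
        splice_list \<kappa> ys (blocks f G ?us) ! (y + p + i)"
      using norep_uptoD[OF chk y p] p(1) sp y w(4) by auto
    then show ?thesis using W_context_mismatch[of 0 i p y] sp y w(4) by auto
  qed
  have second: "\<exists>i\<le>p div d. W (n - (L + \<kappa>) + y + i) \<noteq> W (n - (L + \<kappa>) + y + p + i)" if y: "y < L" for y
  proof -
    let ?us = "map u [m - 1..<m - 1 + 4]"
    have chk: "norep_upto L (excesses d P 0) (splice_list (L + \<kappa>) ys (blocks f G ?us))"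
      using insert_check u_contexts[of "m - 1" 4] u_m m unfolding insert_check_def Let_def list_all_iff
      by (simp del: upt_Suc)
    obtain i where i: "i \<le> p div d" "splice_list (L + \<kappa>) ys (blocks f G ?us) ! (y + i) \<noteq>
        splice_list (L + \<kappa>) ys (blocks f G ?us) ! (y + p + i)"
      using norep_uptoD[OF chk y p] p(1) sp y by auto
    then show ?thesis using W_context_mismatch[of 1 i p y] sp y by auto
  qed
  \<comment> \<open>A start in the second block before the split one can reach past the end of the
    circle only from the last \<open>L\<close> - \<kappa> positions of that block, which is why
    \<kappa> letters are dropped.\<close>
  have third: "\<exists>i\<le>p div d. W (n - (2 * L + \<kappa>) + (\<kappa> + y) + i) \<noteq> W (n - (2 * L + \<kappa>) + (\<kappa> + y) + p + i)"
    if y: "y < L - \<kappa>" for y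
  proof -
    let ?us = "map u [m - 2..<m - 2 + 4]"
    let ?s = "splice_list (2 * L + \<kappa>) ys (blocks f G ?us)"
    have "?us ! i = u (m - 2 + i)" if "i < 4" for i using that by (simp del: upt_Suc)
    then have nth: "?us ! 2 = u (m - 2 + 2)" "?us ! 3 = u (m - 2 + 3)" by fastforce+
    have "m - 2 + 2 = m" "m - 2 + 3 = Suc m" using m by simp_all
    then have "?us ! 2 = 0" "?us ! 3 = 1" by (simp_all only: nth u_m)
    moreover have "\<forall>us\<in>set (contexts k d 4). us ! 2 = 0 \<and> us ! 3 = 1 \<longrightarrow>
        norep_upto (L - \<kappa>) (excesses d P 0) (drop \<kappa> (splice_list (2 * L + \<kappa>) ys (blocks f G us)))"
      using insert_check by (simp add: insert_check_def Let_def list_all_iff)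
    ultimately have chk: "norep_upto (L - \<kappa>) (excesses d P 0) (drop \<kappa> ?s)"
      using u_contexts[of "m - 2" 4] by blast
    have "length (drop \<kappa> ?s) = L * 3 + r - \<kappa>" by simp
    then have "y + p + p div d < length (drop \<kappa> ?s)" using sp y by linarith
    then obtain i where i: "i \<le> p div d" "drop \<kappa> ?s ! (y + i) \<noteq> drop \<kappa> ?s ! (y + p + i)"
      using norep_uptoD[OF chk y p] p(1) by auto
    then have "?s ! (\<kappa> + y + i) \<noteq> ?s ! (\<kappa> + y + p + i)"
      using sp y by (simp add: add.assoc)
    moreover have "\<kappa> + y + p + p div d < 3 * L + r" using sp y by linarith
    ultimately show ?thesis using W_context_mismatch[of 2 i p "\<kappa> + y"] i(1) by auto
  qed
  consider "x0 < r" | "r \<le> x0" "x0 + p + p div d < n" | "r \<le> x0" "n \<le> x0 + p + p div d"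
    by linarith
  then show ?thesis
  proof cases
    case 1
    have eq: "n - \<kappa> + (\<kappa> + x0) = x0 + n" using n_ge w(4) by linarith
    show ?thesis using via[of "x0 + n"] first[of "\<kappa> + x0"] 1 x0 unfolding eq by simp
  next
    case 2
    have "p < L * m" using sp n_ge by linarith
    then obtain i where i: "i \<le> p div d" "v (x0 - r + \<kappa> + i) \<noteq> v (x0 - r + \<kappa> + p + i)"
      using v_mismatch[OF p(1)] by blast
    then have "W (x0 + i) \<noteq> W (x0 + p + i)"
      using W_stretch[OF 2(1), of i] W_stretch[OF 2(1), of "p + i"] 2(2) by (simp add: add.assoc)
    then show ?thesis using via[of x0] i(1) x0 by auto
  next
    case 3
    \<comment> \<open>The distance to the end of the circle, where \<open>ys\<close> follows.
      Comparing it with \<kappa> and \<open>L\<close> + \<kappa> tells in which block the repetition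
      starts.\<close>
    define \<delta> where "\<delta> = n - x0"
    have \<delta>: "0 < \<delta>" "\<delta> < 2 * L" "x0 = n - \<delta>" using 3 x0 sp by (auto simp: \<delta>_def)
    consider "\<delta> \<le> \<kappa>" | "\<kappa> < \<delta>" "\<delta> \<le> L + \<kappa>" | "L + \<kappa> < \<delta>" by linarith
    then show ?thesis
    proof cases
      case 1
      have eq: "n - \<kappa> + (\<kappa> - \<delta>) = x0" using 1 \<delta> n_ge w(4) by linarith
      show ?thesis using via[of x0] first[of "\<kappa> - \<delta>"] 1 \<delta>(1) x0 unfolding eq by simp
    next
      case 2
      have eq: "n - (L + \<kappa>) + (L + \<kappa> - \<delta>) = x0" using 2 \<delta> n_ge w(4) by linarith
      show ?thesis using via[of x0] second[of "L + \<kappa> - \<delta>"] 2 \<delta>(1) x0 unfolding eq by simp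
    next
      case 3
      have eq: "n - (2 * L + \<kappa>) + (\<kappa> + (2 * L - \<delta>)) = x0" using 3 \<delta> n_ge w(4) by linarith
      have "2 * L - \<delta> < L - \<kappa>" using 3 \<delta>(2) by linarith
      then show ?thesis using via[of x0] third[of "2 * L - \<delta>"] x0 unfolding eq by simp
    qed
  qed
qed

text \<open>The window of length w at x meets the inserted word iff touch x < r + (w - 1), and then
  touch x tells where.\<close>

abbreviation "touch x \<equiv> (x + (w - 1)) mod n"
abbreviation "win x \<equiv> map (\<lambda>i. W (x + i)) [0..<w]"

lemma W_touch: "W (n - (w - 1) + touch x + i) = W (x + i)"
proof (rule W_cong)
  have "(n - (w - 1) + touch x + i) mod n = (n - (w - 1) + (x + (w - 1)) + i) mod n"
    by (rule mod_add_middle)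
  also have "n - (w - 1) + (x + (w - 1)) + i = x + i + n" using n_ge w by linarith
  finally show "(n - (w - 1) + touch x + i) mod n = (x + i) mod n" by simp
qed

lemma touching_window:
  assumes t: "touch x < r + (w - 1)"
  shows "(win x, touch x) \<in> set (insert_windows k d w \<kappa> f G ys)"
proof -
  let ?us = "map u [m..<m + 3]"
  let ?s = "splice_list \<kappa> ys (blocks f G ?us)"
  have us: "?us \<in> set (contexts k d 3)" "?us ! 0 = 0" "?us ! 1 = 1"
    using u_contexts[of m 3] u_periodic[of 0] u_periodic[of 1] u01 by (simp_all del: upt_Suc)
  have len: "length ?s = L * 2 + r" by simp
  have ran: "\<kappa> - (w - 1) + touch x + w \<le> L * 2 + r" using t w by linarith
  have "win x = take w (drop (touch x) (drop (\<kappa> - (w - 1)) ?s))"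
  proof (rule nth_equalityI)
    show "length (win x) = length (take w (drop (touch x) (drop (\<kappa> - (w - 1)) ?s)))"
      using ran by (simp add: len del: length_splice_list)
    fix i assume "i < length (win x)"
    then have i: "i < w" by simp
    have "win x ! i = W (x + i)" using i by simp
    also have "\<dots> = W (n - (w - 1) + touch x + i)" by (rule W_touch[symmetric])
    also have "n - (w - 1) + touch x + i = n - (0 * L + \<kappa>) + (\<kappa> - (w - 1) + touch x + i)"
    proof -
      have "N - c + T + i = N - (0 * l + K) + (K - c + T + i)" if "c \<le> K" "K \<le> N" for N c T l K :: nat
        using that by simp
      moreover have "\<kappa> \<le> n" using w(4) n_ge by linarith
      ultimately show ?thesis using w(3) by blast
    qed
    also have "W \<dots> = ?s ! (\<kappa> - (w - 1) + touch x + i)"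
      using W_context[of 0 2 "\<kappa> - (w - 1) + touch x + i"] ran i by (simp add: eval_nat_numeral)
    also have "\<dots> = take w (drop (touch x) (drop (\<kappa> - (w - 1)) ?s)) ! i"
      by (rule nth_take_drop_drop[symmetric]) (use i ran in \<open>simp_all only: len\<close>)
    finally show "win x ! i = take w (drop (touch x) (drop (\<kappa> - (w - 1)) ?s)) ! i" .
  qed
  moreover have "(take w (drop (touch x) (drop (\<kappa> - (w - 1)) ?s)), 0 + touch x) \<in>
      set (windows (r + w - 1) w 0 (drop (\<kappa> - (w - 1)) ?s))"
    by (rule in_windows) (use t w(1) in linarith)
  ultimately show ?thesis unfolding insert_windows_def using us by force
qed

lemma nontouching_window:
  assumes t: "r + (w - 1) \<le> touch x" and i: "i < w"
  shows "W (x + i) = v (touch x - (w - 1) - r + \<kappa> + i)"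
proof -
  have "touch x < n" using n_ge L_pos by simp
  have "W (x + i) = W (n - (w - 1) + touch x + i)" by (rule W_touch[symmetric])
  also have "\<dots> = W (touch x - (w - 1) + i)"
  proof (rule W_cong)
    have "n - (w - 1) + touch x + i = touch x - (w - 1) + i + n" using t n_ge w by linarith
    then show "(n - (w - 1) + touch x + i) mod n = (touch x - (w - 1) + i) mod n"
      by (simp only: mod_add_self2)
  qed
  also have "\<dots> = v (touch x - (w - 1) - r + \<kappa> + i)"
    by (rule W_stretch) (use t i \<open>touch x < n\<close> in linarith)+
  finally show ?thesis .
qed

text \<open>If both windows meet the insertion, the second half of \<open>window_check\<close>
  applies. Otherwise the common normal form would carry both the label \<open>L\<close> and an
  offset smaller than \<open>L\<close>.\<close>

lemma touching_unique:
  assumes eq: "win x = win y" and t: "touch x < r + (w - 1)"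
  shows "touch y = touch x"
proof (cases "touch y < r + (w - 1)")
  case True
  have "separated k w (insert_windows k d w \<kappa> f G ys)"
    using window_check by (simp add: window_check_def)
  then show ?thesis
    by (rule separatedD[OF _ touching_window[OF True] touching_window[OF t, unfolded eq]])
      (use W_less in auto)
next
  case False
  let ?z = "touch y - (w - 1) - r + \<kappa>"
  let ?c = "canon g (map (\<lambda>i. v (?z + i)) [0..<w])"
  have wy: "win y = map (\<lambda>i. v (?z + i)) [0..<w]"
  proof (rule map_cong)
    fix i assume "i \<in> set [0..<w]"
    then show "W (y + i) = v (?z + i)"
      by (intro nontouching_window) (use False in \<open>simp_all only: not_less set_upt atLeastLessThan_iff\<close>)
  qed simp
  have "(canon g (win x), L) \<in> (\<lambda>(v, _). (canon g v, L)) ` set (insert_windows k d w \<kappa> f G ys)"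
    by (rule image_eqI[OF _ touching_window[OF t]]) simp
  then have "(?c, L) \<in> (\<lambda>(v, _). (canon g v, L)) ` set (insert_windows k d w \<kappa> f G ys)"
    by (simp only: eq wy)
  moreover have "(?c, ?z mod L) \<in> set (block_windows k d w f g G)" by (rule block_window)
  moreover have "set ?c \<subseteq> {..<k}"
    using g_less v_less v_adjacent w(1) unfolding canon_def by auto
  moreover have "w \<le> length ?c" by (simp add: canon_def)
  moreover have "separated k w (block_windows k d w f g G @
      map (\<lambda>(v, _). (canon g v, L)) (insert_windows k d w \<kappa> f G ys))" (is "separated k w ?ws")
    using window_check by (simp add: window_check_def)
  ultimately have "separated k w ?ws" "(?c, L) \<in> set ?ws" "(?c, ?z mod L) \<in> set ?ws"
      "w \<le> length ?c" "set ?c \<subseteq> {..<k}"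
    by (simp_all only: set_append set_map Un_iff simp_thms)
  then have "L = ?z mod L" by (rule separatedD)
  then show ?thesis using L_pos mod_less_divisor[of L ?z] by linarith
qed

lemma nontouching_stretch:
  assumes x: "x < n" and e: "w \<le> e" and t: "\<And>j. j \<le> e - w \<Longrightarrow> r + (w - 1) \<le> touch (x + j)"
  shows "r \<le> x \<and> x + e \<le> n"
proof -
  have npos: "0 < n" and wn: "w < n" using n_ge L_pos w by linarith+
  have t0: "r + (w - 1) \<le> touch x" using t[of 0] by simp
  have xw: "x + (w - 1) < n"
  proof (rule ccontr)
    assume c: "\<not> x + (w - 1) < n"
    then have "touch x = x + (w - 1) - n" using x wn by (simp add: le_mod_geq)
    then show False using t0 x c by linarith
  qed
  then have "touch x = x + (w - 1)" by simp
  then have "r \<le> x" using t0 by simp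
  moreover have "x + e \<le> n"
  proof (rule ccontr)
    assume c: "\<not> x + e \<le> n"
    \<comment> \<open>The window shifted by \<open>j\<close> ends exactly at position
      \<open>n\<close>, where the next turn of the circle begins, so its \<open>touch\<close> is
      0.\<close>
    define j where "j = n - (x + (w - 1))"
    have "touch (x + j) = 0" using xw by (simp add: j_def)
    moreover have "j \<le> e - w" using c e w(1) xw unfolding j_def by linarith
    ultimately show False using t[of j] w(1) by linarith
  qed
  ultimately show ?thesis by blast
qed

text \<open>The repeated factor has at least \<open>w\<close> letters. If one of its windows met the
  insertion, the window \<open>p\<close> later would meet it at the same place, forcing
  \<open>n\<close> to divide \<open>p\<close>. So both copies avoid \<open>ys\<close>; deleting
  \<open>ys\<close> gives a repetition in \<open>v\<close> with the same matching length and no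
  larger period, contrary to \<open>v_mismatch\<close>.\<close>

lemma W_large:
  assumes p: "P \<le> p" "2 * p \<le> n"
  shows "\<exists>i\<le>p div d. W (x + i) \<noteq> W (x + p + i)"
proof (rule ccontr)
  assume no: "\<not> ?thesis"
  define x0 where "x0 = x mod n"
  define y0 where "y0 = (x0 + p) mod n"
  define e where "e = p div d + 1"
  have npos: "0 < n" using n_ge L_pos by linarith
  have x0: "x0 < n" "y0 < n" using npos by (simp_all add: x0_def y0_def)
  have p1: "1 \<le> p" "p < n" using p P_ge npos by linarith+
  have "w - 1 \<le> p div d" using p(1) d(1) div_le_mono[of P p d] by simp
  then have e: "w \<le> e" by (simp add: e_def)
  have eq: "W (x0 + i) = W (y0 + i)" if "i < e" for i
  proof -
    have "W (x0 + i) = W (x + i)" by (simp add: x0_def W_mod)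
    also have "\<dots> = W (x + p + i)" using no that unfolding e_def by auto
    also have "\<dots> = W (y0 + i)"
      unfolding x0_def y0_def by (rule W_cong) (simp add: mod_simps)
    finally show ?thesis .
  qed
  have nt: "r + (w - 1) \<le> touch (x0 + j) \<and> r + (w - 1) \<le> touch (y0 + j)" if j: "j \<le> e - w" for j
  proof (rule ccontr)
    assume c: "\<not> ?thesis"
    have we: "win (x0 + j) = win (y0 + j)"
    proof (rule map_cong)
      fix i assume "i \<in> set [0..<w]"
      then have "j + i < e" using j e by simp
      then show "W (x0 + j + i) = W (y0 + j + i)" using eq[of "j + i"] by (simp add: add.assoc)
    qed simp
    have "touch (x0 + j) = touch (y0 + j)"
      using c touching_unique[OF we] touching_unique[OF we[symmetric]] by fastforce
    also have "\<dots> = (x0 + p + (j + (w - 1))) mod n"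
      unfolding y0_def add.assoc[of _ j] by (rule mod_add_left_eq)
    also have "x0 + p + (j + (w - 1)) = x0 + j + (w - 1) + p" by simp
    finally have "n dvd p" using mod_eq_dvd_iff_nat[of "x0 + j + (w - 1)" "x0 + j + (w - 1) + p" n] by simp
    then show False using p1 by (auto dest: dvd_imp_le)
  qed
  have sx: "r \<le> x0" "x0 + e \<le> n" using nontouching_stretch[OF x0(1) e] nt by blast+
  have sy: "r \<le> y0" "y0 + e \<le> n" using nontouching_stretch[OF x0(2) e] nt by blast+
  have veq: "v (x0 - r + \<kappa> + i) = v (y0 - r + \<kappa> + i)" if "i < e" for i
    using eq[OF that] W_stretch[OF sx(1), of i] W_stretch[OF sy(1), of i] that sx(2) sy(2) by simp
  \<comment> \<open>The period after deleting \<open>ys\<close>: it stays \<open>p\<close> if the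
    second copy is reached without completing the circle, and is \<open>p - r\<close> if the step
    from one copy to the other passes over the insertion.\<close>
  have "\<exists>q. 1 \<le> q \<and> q < L * m \<and> q \<le> p \<and> (\<forall>i<e. v (x0 - r + \<kappa> + i) = v (x0 - r + \<kappa> + q + i))"
  proof (cases "x0 + p < n")
    case True
    then have y0: "y0 = x0 + p" by (simp add: y0_def)
    have "p < L * m" using p(2) n_ge k(4) by linarith
    moreover have e1: "x0 - r + \<kappa> + p = y0 - r + \<kappa>" using y0 sx by linarith
    moreover have "\<forall>i<e. v (x0 - r + \<kappa> + i) = v (x0 - r + \<kappa> + p + i)"
      unfolding e1 using veq by blast
    ultimately show ?thesis using p1(1) by blast
  next
    case False
    then have y0: "x0 + p = y0 + n" unfolding y0_def using x0 p1 by (simp add: le_mod_geq)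
    have q: "1 \<le> p - r" "p - r < L * m" "x0 - r + \<kappa> + (p - r) = y0 - r + \<kappa> + L * m"
      using y0 sx sy e w(1) p1 by linarith+
    have "v (y0 - r + \<kappa> + L * m + i) = v (y0 - r + \<kappa> + i)" for i
      using v_periodic[of "y0 - r + \<kappa> + i"] by (simp only: ac_simps)
    then have "\<forall>i<e. v (x0 - r + \<kappa> + i) = v (x0 - r + \<kappa> + (p - r) + i)"
      unfolding q(3) using veq by simp
    then show ?thesis using q(1,2) diff_le_self by blast
  qed
  then obtain q where q: "1 \<le> q" "q < L * m" "q \<le> p"
    "\<forall>i<e. v (x0 - r + \<kappa> + i) = v (x0 - r + \<kappa> + q + i)" by blast
  obtain i where i: "i \<le> q div d" "v (x0 - r + \<kappa> + i) \<noteq> v (x0 - r + \<kappa> + q + i)"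
    using v_mismatch[OF q(1,2)] by blast
  have "q div d \<le> p div d" by (rule div_le_mono[OF q(3)])
  then have "i < e" using i(1) by (simp add: e_def)
  then show False using q(4) i(2) by blast
qed

lemma good_W: "good d n W"
  unfolding good_def
proof (intro conjI allI impI)
  show "W (x + n) = W x" for x by (rule W_cong) simp
  show "\<exists>i\<le>p div d. W (x + i) \<noteq> W (x + p + i)" if "1 \<le> p" "2 * p \<le> n" for p x
    using W_small[OF that(1)] W_large[OF _ that(2)] by (cases "p < P") auto
qed

end

section \<open>Circular words\<close>

text \<open>Two copies of \<open>us\<close> suffice: a start in the first copy and a period of at
  most half the length keep the compared positions within them.\<close>

definition good_word_check :: "nat \<Rightarrow> nat \<Rightarrow> nat list \<Rightarrow> bool" where
  "good_word_check k d us \<longleftrightarrow> list_all (\<lambda>c. c < k) us \<and>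
     norep_upto (length us) (excesses d (Suc (length us div 2)) 0) (us @ us)"

lemma good_periodic_word:
  assumes "good_word_check k d us" "us \<noteq> []"
  shows "good d (length us) (\<lambda>x. us ! (x mod length us)) \<and> (\<forall>x. us ! (x mod length us) < k)"
proof (intro conjI allI)
  let ?n = "length us"
  have n: "0 < ?n" using assms(2) by simp
  show "us ! (x mod ?n) < k" for x
    using assms n nth_mem[of "x mod ?n" us] by (auto simp: good_word_check_def list_all_iff)
  show "good d ?n (\<lambda>x. us ! (x mod ?n))"
    unfolding good_def
  proof (intro conjI allI impI)
    fix p x assume p: "1 \<le> p" "2 * p \<le> ?n"
    define x0 where "x0 = x mod ?n"
    have x0: "x0 < ?n" using n by (simp add: x0_def)
    have chk: "norep_upto ?n (excesses d (Suc (?n div 2)) 0) (us @ us)"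
      using assms(1) by (simp add: good_word_check_def)
    have pd: "p div d \<le> p" by simp
    have ph: "p < Suc (?n div 2)" using p(2) by linarith
    have rng: "x0 + p + p div d < 2 * ?n" using p x0 pd by linarith
    obtain i where i: "i \<le> p div d" "(us @ us) ! (x0 + i) \<noteq> (us @ us) ! (x0 + p + i)"
      using norep_uptoD[OF chk x0 p(1) ph] p rng by auto
    have "(us @ us) ! y = us ! (y mod ?n)" if "y < 2 * ?n" for y
      using that by (auto simp: nth_append le_mod_geq)
    then have "us ! ((x0 + i) mod ?n) \<noteq> us ! ((x0 + p + i) mod ?n)"
      using i rng by simp
    then show "\<exists>i\<le>p div d. us ! ((x + i) mod ?n) \<noteq> us ! ((x + p + i) mod ?n)"
      using i(1) unfolding x0_def by (auto simp: mod_simps add.assoc)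
  qed simp
qed

lemma good_relabel:
  assumes u: "good d n u" "2 \<le> n" "\<And>x. u x < k" and d: "2 \<le> d" and k: "2 \<le> (k::nat)"
  obtains u' where "good d n u'" "\<And>x. u' x < k" "u' 0 = (0::nat)" "u' 1 = 1"
proof -
  have ne: "u 0 \<noteq> u 1" using good_mismatch[OF u(1), of 1 0] u(2) d by auto
  let ?\<sigma> = "transpose (u 0) 0"
  \<comment> \<open>This second swap leaves 0 in place because \<open>u 1\<close> has not been sent
    to 0.\<close>
  let ?\<tau> = "transpose (?\<sigma> (u 1)) 1"
  have ne0: "?\<sigma> (u 1) \<noteq> 0" using ne by (metis transpose_apply_first transpose_eq_iff)
  have less: "transpose a b z < k" if "a < k" "b < k" "z < k" for a b z :: nat
    using that by (simp add: transpose_def)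
  show thesis
  proof (rule that)
    show "good d n ((?\<tau> \<circ> ?\<sigma>) \<circ> u)" by (rule good_inj[OF u(1)]) (simp add: inj_compose)
    show "((?\<tau> \<circ> ?\<sigma>) \<circ> u) x < k" for x using u(3) k by (simp add: less)
    show "((?\<tau> \<circ> ?\<sigma>) \<circ> u) 0 = 0" using ne0 by (simp add: transpose_apply_other)
  qed simp
qed

text \<open>A factor with minimal period \<open>p\<close> and exponent above 1 + 1/d has at least
  \<open>p + p div d + 1\<close> letters and at most \<open>n\<close>. Thus \<open>p < n\<close>,
  and \<open>good_mismatch\<close> contradicts the period.\<close>

lemma good_circular_free:
  assumes good: "good d n u" and d: "1 \<le> d" and \<beta>: "1 + 1 / real d < \<beta>"
  shows "circular_free \<beta> (circular_word (map u [0..<n]))"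
  unfolding circular_free_def
proof
  assume "\<exists>x. x \<noteq> [] \<and> circular_factor x (circular_word (map u [0..<n])) \<and> \<beta> \<le> exponent x"
  then obtain x w' where x: "x \<noteq> []" "\<beta> \<le> exponent x" and w': "conjugate (map u [0..<n]) w'" "sublist x w'"
    by (auto simp: circular_factor_def circular_word_def)
  obtain a b where ab: "map u [0..<n] = a @ b" and "w' = b @ a"
    using w'(1) unfolding conjugate_def by blast
  moreover obtain ys zs where "w' = ys @ x @ zs" using w'(2) unfolding sublist_def by blast
  ultimately have fac: "b @ a = ys @ x @ zs" by simp
  have n: "length a + length b = n" using arg_cong[OF ab, of length] by simp
  have ba: "(b @ a) ! i = u (length a + i)" if i: "i < n" for i
  proof (cases "i < length b")
    case True
    have "map u [0..<n] ! (length a + i) = (b @ a) ! i" unfolding ab using True by (simp add: nth_append)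
    then show ?thesis using True n by simp
  next
    case False
    have "map u [0..<n] ! (i - length b) = (b @ a) ! i"
    proof -
      have "i - length b < length a" using False i n by linarith
      then show ?thesis unfolding ab using False by (simp add: nth_append)
    qed
    then have "(b @ a) ! i = u (i - length b)" using i by simp
    also have "\<dots> = u (i - length b + n)" using good by (simp add: good_def)
    also have "i - length b + n = length a + i" using False n by simp
    finally show ?thesis .
  qed
  define s where "s = length a + length ys"
  have len: "length ys + length x \<le> n" using arg_cong[OF fac, of length] n by simp
  have xs: "x ! i = u (s + i)" if "i < length x" for i
    using ba[of "length ys + i"] that len unfolding fac s_def by (simp add: nth_append add.assoc)
  define p where "p = min_period x"
  \<comment> \<open>Some period exists, so the \<open>LEAST\<close> in \<open>min_period\<close> is
    attained.\<close>
  have "has_period x (length x)" using x(1) by (simp add: has_period_def Suc_le_eq)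
  then have per: "has_period x p" unfolding p_def min_period_def by (rule LeastI)
  then have p1: "1 \<le> p" by (simp add: has_period_def)
  have "\<beta> * real p \<le> real (length x)"
    using x(2) p1 unfolding exponent_def p_def[symmetric] by (simp add: pos_le_divide_eq)
  moreover have "(1 + 1 / real d) * real p < \<beta> * real p" using \<beta> p1 by simp
  ultimately have "real p + real p / real d < real (length x)" by (simp add: algebra_simps)
  moreover have "real (p div d) \<le> real p / real d"
  proof -
    have "real (p div d * d) \<le> real p" by (simp only: of_nat_le_iff div_times_less_eq_dividend)
    then show ?thesis using d by (simp add: pos_le_divide_eq)
  qed
  ultimately have pl: "p + p div d < length x" by linarith
  obtain i where i: "i \<le> p div d" "u (s + i) \<noteq> u (s + p + i)"
    using good_mismatch[OF good p1, of s] pl len by auto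
  have "x ! (i + p) = x ! i" using per i(1) pl by (simp add: has_period_def)
  moreover have "x ! (i + p) = u (s + p + i)" "x ! i = u (s + i)"
    using xs[of "i + p"] xs[of i] i(1) pl by (simp_all add: ac_simps)
  ultimately show False using i(2) by simp
qed

section \<open>The lower bound and the value of the threshold\<close>

lemma circular_free_repeat:
  assumes free: "circular_free \<beta> (circular_word w)" and w': "conjugate w w'"
    and f: "1 \<le> f" "a + f < length w'" and eq: "w' ! a = w' ! (a + f)"
  shows "1 + 1 / real f < \<beta>"
proof (rule ccontr)
  assume "\<not> ?thesis"
  then have \<beta>: "\<beta> \<le> 1 + 1 / real f" by simp
  \<comment> \<open>The factor from one occurrence of the letter to the other has period
    \<open>f\<close> and length \<open>f + 1\<close>; a smaller minimal period only raises its
    exponent.\<close>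
  let ?x = "take (f + 1) (drop a w')"
  have len: "length ?x = f + 1" using f by simp
  have "has_period ?x f"
    using f eq by (auto simp: has_period_def)
  then have le: "min_period ?x \<le> f" and per: "has_period ?x (min_period ?x)"
    unfolding min_period_def by (rule Least_le, rule LeastI)
  then have pos: "0 < min_period ?x" by (simp add: has_period_def)
  have "1 + 1 / real f = real (f + 1) / real f" using f(1) by (simp add: field_simps)
  also have "\<dots> \<le> exponent ?x"
    unfolding exponent_def len using le pos by (intro divide_left_mono) auto
  finally have "\<beta> \<le> exponent ?x" using \<beta> by linarith
  moreover have "sublist ?x w'"
    by (metis append_take_drop_id sublist_def)
  then have "circular_factor ?x (circular_word w)"
    using w' by (auto simp: circular_factor_def circular_word_def)
  moreover have "?x \<noteq> []" using len by auto
  ultimately show False using free unfolding circular_free_def by blast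
qed

lemma circular_free_lower_bound:
  assumes k: "1 \<le> k" and w: "length w = k + 1" "set w \<subseteq> {..<k}" and free: "circular_free \<beta> (circular_word w)"
  shows "1 + 1 / real ((k + 1) div 2) < \<beta>"
proof -
  have "\<not> distinct w"
  proof
    assume "distinct w"
    then have "card (set w) = k + 1" using w by (simp add: distinct_card)
    moreover have "card (set w) \<le> card {..<k}" using w(2) by (intro card_mono) auto
    ultimately show False by simp
  qed
  then obtain i0 j0 where "i0 \<noteq> j0" "i0 < length w" "j0 < length w" "w ! i0 = w ! j0"
    by (auto simp: distinct_conv_nth)
  then obtain i j where ij: "i < j" "j < length w" "w ! i = w ! j"
    by (metis nat_neq_iff)
  have "\<exists>f\<ge>1. f \<le> (k + 1) div 2 \<and> 1 + 1 / real f < \<beta>"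
  proof (cases "j - i \<le> (k + 1) div 2")
    case True
    have "conjugate w w" unfolding conjugate_def by (intro exI[of _ "[]"] exI[of _ w]) simp
    then have "1 + 1 / real (j - i) < \<beta>"
      by (rule circular_free_repeat[OF free, of _ _ i]) (use ij in auto)
    then show ?thesis using True ij(1) by (intro exI[of _ "j - i"]) auto
  next
    case False
    \<comment> \<open>The two ways around the circle between the equal letters add up to
      \<open>k + 1\<close>, so the other way is short here. Rotating \<open>w\<close> to start at
      \<open>j\<close> makes it a linear factor.\<close>
    let ?f = "length w - (j - i)"
    have "conjugate w (drop j w @ take j w)"
      unfolding conjugate_def by (intro exI[of _ "take j w"] exI[of _ "drop j w"]) simp
    then have "1 + 1 / real ?f < \<beta>"
    proof (rule circular_free_repeat[OF free, of _ _ 0])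
      show "(drop j w @ take j w) ! 0 = (drop j w @ take j w) ! (0 + ?f)"
      proof -
        have "\<not> ?f < length w - j" "?f - (length w - j) = i" using ij by linarith+
        then show ?thesis using ij by (simp add: nth_append del: diff_diff_right)
      qed
    qed (use ij in auto)
    moreover have "?f \<le> (k + 1) div 2" using False ij w(1) by linarith
    ultimately show ?thesis using ij by (intro exI[of _ ?f]) auto
  qed
  then obtain f where f: "1 \<le> f" "f \<le> (k + 1) div 2" "1 + 1 / real f < \<beta>" by blast
  then have "1 / real ((k + 1) div 2) \<le> 1 / real f" by (intro divide_left_mono) auto
  then show ?thesis using f(3) by linarith
qed

lemma CRT_S_eq:
  assumes k: "1 \<le> k" and c: "c = (k + 1) div 2" "1 \<le> c"
    and words: "\<And>n. 1 \<le> n \<Longrightarrow> \<exists>u. good c n u \<and> (\<forall>x. u x < k)"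
  shows "CRT_S k = ereal (1 + 1 / real c)"
  unfolding CRT_S_def
proof (rule antisym)
  let ?S = "{ereal \<beta> | \<beta>. \<forall>n\<ge>1. \<exists>w :: nat list.
      length w = n \<and> set w \<subseteq> {..<k} \<and> circular_free \<beta> (circular_word w)}"
  show "Inf ?S \<le> ereal (1 + 1 / real c)"
  \<comment> \<open>Good words may contain factors of exponent exactly 1 + 1/c, so freeness is
    available only for larger values.\<close>
  proof (rule ereal_le_epsilon2)
    fix e :: real assume e: "0 < e"
    have "\<exists>w. length w = n \<and> set w \<subseteq> {..<k} \<and> circular_free (1 + 1 / real c + e) (circular_word w)"
      if "1 \<le> n" for n
    proof -
      obtain u where u: "good c n u" "\<forall>x. u x < k" using words \<open>1 \<le> n\<close> by blast
      then show ?thesis using good_circular_free[OF u(1) c(2), of "1 + 1 / real c + e"] e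
        by (intro exI[of _ "map u [0..<n]"]) auto
    qed
    then have "ereal (1 + 1 / real c + e) \<in> ?S" by blast
    then have "Inf ?S \<le> ereal (1 + 1 / real c + e)" by (rule Inf_lower)
    then show "Inf ?S \<le> ereal (1 + 1 / real c) + ereal e" by simp
  qed
  show "ereal (1 + 1 / real c) \<le> Inf ?S"
  proof (rule Inf_greatest)
    fix z assume "z \<in> ?S"
    then obtain \<beta> where z: "z = ereal \<beta>" and "\<forall>n\<ge>1. \<exists>w :: nat list.
        length w = n \<and> set w \<subseteq> {..<k} \<and> circular_free \<beta> (circular_word w)" by blast
    then obtain w :: "nat list" where "length w = k + 1" "set w \<subseteq> {..<k}" "circular_free \<beta> (circular_word w)"
      by (meson le_add2)
    from circular_free_lower_bound[OF k this] show "ereal (1 + 1 / real c) \<le> z"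
      by (simp add: z c(1))
  qed
qed

text \<open>Strong induction, writing n = L m + (r0 + j) with j < L: the length of the insertion
  absorbs the residue modulo L. The short words cover all lengths for which m would be smaller than
  4.\<close>

lemma good_words_exist:
  assumes d2: "2 \<le> d" and k2: "2 \<le> k" and L: "0 < length G"
    and substitution: "\<And>ys. ys \<in> set inserts \<Longrightarrow> substitution k d w \<kappa> f g G ys"
    and inserts: "map length inserts = [r0..<r0 + length G]"
    and short: "list_all (good_word_check k d) short" "map length short = [1..<4 * length G + r0]"
    and n: "1 \<le> n"
  shows "\<exists>u. good d n u \<and> (\<forall>x. u x < k)"
  using n
proof (induction n rule: less_induct)
  case (less n)
  let ?L = "length G"
  show ?case
  proof (cases "n < 4 * ?L + r0")
    case True
    then have "n \<in> set (map length short)" using less.prems unfolding short(2) by simp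
    then obtain us where "us \<in> set short" "length us = n" by auto
    moreover from this have "good_word_check k d us" "us \<noteq> []"
      using short(1) less.prems by (auto simp: list_all_iff)
    ultimately show ?thesis
      using good_periodic_word[of k d us] by (intro exI[of _ "\<lambda>x. us ! (x mod length us)"]) simp
  next
    case False
    define m where "m = (n - r0) div ?L"
    define j where "j = (n - r0) mod ?L"
    have n: "n = ?L * m + (r0 + j)" using False unfolding m_def j_def by simp
    have j: "j < ?L" using L by (simp add: j_def)
    have "4 * ?L div ?L \<le> m" unfolding m_def using False by (intro div_le_mono) linarith
    then have m: "4 \<le> m" using L by simp
    have "length (map length inserts) = ?L" unfolding inserts by simp
    then have jl: "j < length inserts" using j by simp
    have "map length inserts ! j = r0 + j" unfolding inserts using j by simp
    then have len: "length (inserts ! j) = r0 + j" using jl by simp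
    interpret substitution k d w \<kappa> f g G "inserts ! j"
      using substitution[OF nth_mem[OF jl]] .
    have "2 \<le> ?L" using d by linarith
    then have "2 * m \<le> ?L * m" by simp
    then have "m < n" using n m by linarith
    then obtain u0 where u0: "good d m u0" "\<And>x. u0 x < k" using less.IH[of m] m by auto
    have "2 \<le> m" using m by simp
    then obtain u where u: "good d m u" "\<And>x. u x < k" "u 0 = 0" "u 1 = 1"
      using good_relabel[OF u0(1) _ u0(2) d2 k2] by blast
    interpret substituted k d w \<kappa> f g G "inserts ! j" m u
      by unfold_locales (use u m in auto)
    show ?thesis using good_W W_less len n by auto
  qed
qed

section \<open>Four and five letters\<close>

definition frame_check :: "nat \<Rightarrow> nat list list list \<Rightarrow> nat list list list \<Rightarrow> bool" where
  "frame_check k F H \<longleftrightarrow> list_all (\<lambda>a. list_all (\<lambda>b. a = b \<or>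
     (let p = F ! a ! b; q = H ! a ! b in
       length p = k \<and> length q = k \<and> p ! 0 = a \<and> p ! 1 = b \<and> distinct q \<and>
       list_all (\<lambda>z. z < k) p \<and> list_all (\<lambda>z. z < k) q \<and>
       list_all (\<lambda>x. list_all (\<lambda>y. x = y \<or>
         (F ! (p ! x) ! (p ! y) = map (nth p) (F ! x ! y) \<and>
          map (nth (H ! (p ! x) ! (p ! y))) p = H ! x ! y)) [0..<k]) [0..<k])) [0..<k]) [0..<k]"

lemma frame_check_maps:
  assumes "frame_check k F H"
  shows "frame_maps k (\<lambda>a b. nth (F ! a ! b)) (\<lambda>a b. nth (H ! a ! b))"
proof -
  have *: "length (F ! a ! b) = k \<and> length (H ! a ! b) = k \<and> F ! a ! b ! 0 = a \<and> F ! a ! b ! 1 = b \<and>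
      distinct (H ! a ! b) \<and> (\<forall>z\<in>set (F ! a ! b). z < k) \<and> (\<forall>z\<in>set (H ! a ! b). z < k) \<and>
      (\<forall>x<k. \<forall>y<k. x \<noteq> y \<longrightarrow>
        F ! (F ! a ! b ! x) ! (F ! a ! b ! y) = map (nth (F ! a ! b)) (F ! x ! y) \<and>
        map (nth (H ! (F ! a ! b ! x) ! (F ! a ! b ! y))) (F ! a ! b) = H ! x ! y)"
    if "a < k" "b < k" "a \<noteq> b" for a b
    using assms[unfolded frame_check_def Let_def list_all_iff, THEN bspec[of _ _ a], THEN bspec[of _ _ b]] that
    by (simp add: Ball_def disj_imp)
  show ?thesis
    unfolding frame_maps_def
  proof (intro allI impI conjI)
    fix a b assume ab: "a < k" "b < k" "a \<noteq> b"
    note ab_table = *[OF ab]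
    show "F ! a ! b ! 0 = a" "F ! a ! b ! 1 = b" using ab_table by blast+
    show "F ! a ! b ! z < k" "H ! a ! b ! z < k" if "z < k" for z
      using ab_table that nth_mem[of z "F ! a ! b"] nth_mem[of z "H ! a ! b"] by auto
    show "inj_on ((!) (H ! a ! b)) {..<k}"
      using ab_table by (auto simp: inj_on_def nth_eq_iff_index_eq)
    fix x y z assume xyz: "x < k" "y < k" "x \<noteq> y" "z < k"
    have "F ! (F ! a ! b ! x) ! (F ! a ! b ! y) = map (nth (F ! a ! b)) (F ! x ! y)"
      using ab_table xyz by blast
    then show "F ! (F ! a ! b ! x) ! (F ! a ! b ! y) ! z = F ! a ! b ! (F ! x ! y ! z)"
      using *[OF xyz(1-3)] xyz(4) by simp
    have "map (nth (H ! (F ! a ! b ! x) ! (F ! a ! b ! y))) (F ! a ! b) = H ! x ! y"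
      using ab_table xyz by blast
    then show "H ! (F ! a ! b ! x) ! (F ! a ! b ! y) ! (F ! a ! b ! z) = H ! x ! y ! z"
      using ab_table xyz(4) by (metis nth_map)
  qed
qed

text \<open>Row a, column b holds the values of z \<mapsto> a + (b - a) z and of its inverse, over the field with
  four elements (2 being a primitive element), resp. modulo 5. The blocks
  and the other words below were found by computer search.\<close>

definition frames4 :: "nat list list list" where
  "frames4 =
   [[[], [0, 1, 2, 3], [0, 2, 3, 1], [0, 3, 1, 2]],
    [[1, 0, 3, 2], [], [1, 2, 0, 3], [1, 3, 2, 0]],
    [[2, 0, 1, 3], [2, 1, 3, 0], [], [2, 3, 0, 1]],
    [[3, 0, 2, 1], [3, 1, 0, 2], [3, 2, 1, 0], []]]"

definition unframes4 :: "nat list list list" where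
  "unframes4 =
   [[[], [0, 1, 2, 3], [0, 3, 1, 2], [0, 2, 3, 1]],
    [[1, 0, 3, 2], [], [2, 0, 1, 3], [3, 0, 2, 1]],
    [[1, 2, 0, 3], [3, 1, 0, 2], [], [2, 3, 0, 1]],
    [[1, 3, 2, 0], [2, 1, 3, 0], [3, 2, 1, 0], []]]"

definition block4 :: "nat list" where
  "block4 = [0, 1, 2, 3, 0, 3, 1, 3, 0, 2]"

definition inserts4 :: "nat list list" where
  "inserts4 =
   [[2, 0, 3, 2],
    [0, 2, 0, 3, 2],
    [0, 1, 3, 0, 3, 2],
    [2, 0, 3, 0, 1, 3, 2],
    [0, 1, 3, 0, 2, 0, 3, 2],
    [0, 1, 3, 0, 2, 3, 1, 3, 2],
    [0, 1, 3, 1, 2, 1, 3, 0, 3, 2],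
    [0, 1, 3, 0, 2, 0, 3, 0, 1, 3, 2],
    [0, 1, 3, 0, 2, 0, 1, 2, 3, 1, 3, 2],
    [0, 1, 3, 0, 2, 0, 1, 2, 1, 0, 1, 3, 2]]"

definition short4 :: "nat list list" where
  "short4 =
   [[0],
    [0, 1],
    [0, 1, 3],
    [0, 1, 0, 2],
    [0, 1, 3, 2, 1],
    [0, 1, 3, 0, 2, 1],
    [0, 1, 2, 0, 2, 1, 3],
    [0, 1, 3, 0, 2, 3, 2, 1],
    [0, 1, 0, 2, 3, 1, 2, 0, 3],
    [0, 1, 3, 0, 3, 2, 1, 3, 1, 2],
    [0, 1, 2, 1, 0, 1, 3, 2, 3, 1, 3],
    [0, 1, 0, 3, 1, 3, 0, 1, 0, 2, 3, 2],
    [0, 1, 0, 2, 0, 3, 2, 3, 1, 0, 2, 1, 3],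
    [0, 1, 3, 0, 3, 2, 0, 2, 3, 2, 1, 3, 1, 2],
    [0, 1, 0, 3, 2, 0, 1, 3, 1, 2, 3, 0, 2, 0, 3],
    [0, 1, 3, 1, 0, 2, 0, 3, 1, 3, 0, 3, 2, 0, 2, 3],
    [0, 1, 3, 2, 1, 0, 3, 2, 3, 1, 3, 2, 1, 2, 3, 0, 2],
    [0, 1, 0, 2, 1, 2, 0, 3, 0, 2, 0, 1, 2, 3, 1, 3, 2, 3],
    [0, 1, 2, 0, 2, 1, 2, 3, 2, 0, 1, 2, 1, 0, 2, 3, 1, 0, 3],
    [0, 1, 0, 3, 1, 3, 0, 2, 1, 3, 1, 2, 0, 1, 0, 3, 0, 2, 1, 3],
    [0, 1, 2, 0, 3, 2, 3, 0, 1, 3, 2, 1, 0, 2, 0, 1, 0, 3, 2, 3, 1],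
    [0, 1, 0, 3, 0, 1, 2, 1, 3, 0, 2, 0, 1, 0, 2, 3, 2, 0, 3, 1, 0, 2],
    [0, 1, 3, 2, 0, 1, 2, 1, 0, 3, 0, 1, 3, 2, 3, 1, 3, 0, 2, 0, 3, 2, 1],
    [0, 1, 0, 2, 3, 2, 0, 3, 0, 2, 3, 1, 0, 2, 1, 3, 0, 2, 3, 2, 1, 3, 1, 2],
    [0, 1, 3, 2, 1, 2, 0, 2, 1, 3, 1, 0, 3, 2, 0, 1, 0, 2, 3, 2, 1, 3, 1, 0, 2],
    [0, 1, 0, 3, 1, 2, 1, 0, 1, 3, 0, 3, 2, 1, 3, 1, 0, 2, 3, 2, 1, 0, 1, 3, 2, 3],
    [0, 1, 0, 3, 0, 2, 1, 3, 0, 3, 2, 1, 2, 0, 3, 1, 0, 2, 3, 1, 3, 2, 0, 3, 1, 2, 3],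
    [0, 1, 0, 3, 2, 1, 3, 1, 0, 2, 0, 3, 1, 3, 0, 3, 2, 3, 1, 0, 1, 2, 3, 2, 0, 2, 1, 3],
    [0, 1, 0, 2, 3, 0, 1, 3, 2, 0, 2, 1, 2, 3, 2, 0, 1, 2, 1, 3, 1, 2, 3, 2, 1, 3, 0, 3, 2],
    [0, 1, 3, 0, 2, 3, 1, 0, 2, 1, 3, 1, 2, 0, 3, 0, 1, 0, 3, 2, 1, 3, 1, 2, 1, 0, 1, 2, 3, 2],
    [0, 1, 0, 3, 1, 3, 0, 2, 3, 1, 2, 1, 0, 1, 3, 0, 2, 0, 1, 2, 3, 1, 0, 2, 1, 2, 3, 2, 1, 0, 2],
    [0, 1, 0, 3, 1, 3, 2, 3, 1, 0, 2, 1, 3, 1, 2, 1, 0, 2, 3, 1, 0, 1, 2, 3, 2, 1, 0, 1, 3, 2, 0, 3],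
    [0, 1, 2, 3, 0, 1, 0, 2, 3, 2, 1, 2, 3, 0, 2, 0, 3, 1, 2, 1, 3, 2, 0, 3, 0, 2, 1, 3, 1, 2, 1, 0, 2],
    [0, 1, 2, 3, 2, 1, 2, 0, 1, 0, 3, 0, 1, 2, 3, 2, 0, 1, 3, 0, 3, 2, 0, 2, 1, 3, 1, 0, 3, 2, 1, 3, 0, 2],
    [0, 1, 0, 3, 1, 3, 0, 3, 2, 0, 2, 3, 1, 0, 2, 1, 3, 1, 2, 1, 0, 2, 0, 1, 3, 1, 2, 3, 0, 3, 2, 0, 2, 1, 3],
    [0, 1, 3, 0, 2, 3, 2, 1, 2, 0, 3, 2, 3, 1, 2, 0, 1, 3, 2, 0, 3, 0, 2, 1, 3, 1, 0, 3, 0, 1, 3, 1, 2, 3, 2, 1],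
    [0, 1, 0, 3, 0, 1, 3, 1, 2, 0, 2, 3, 1, 3, 2, 1, 2, 3, 1, 0, 1, 3, 1, 2, 1, 0, 1, 2, 0, 3, 0, 1, 0, 2, 3, 1, 2],
    [0, 1, 3, 1, 2, 3, 2, 1, 0, 3, 1, 3, 0, 1, 0, 2, 0, 1, 3, 1, 2, 3, 0, 2, 0, 3, 1, 2, 1, 0, 1, 2, 0, 2, 3, 0, 3, 1],
    [0, 1, 2, 0, 2, 3, 0, 3, 1, 0, 2, 1, 3, 2, 3, 0, 2, 1, 0, 3, 2, 0, 2, 3, 2, 1, 2, 0, 3, 0, 1, 2, 1, 3, 2, 0, 3, 1, 3],
    [0, 1, 2, 3, 0, 3, 1, 2, 1, 3, 1, 0, 3, 0, 2, 3, 1, 3, 2, 0, 2, 1, 3, 0, 3, 2, 0, 1, 2, 1, 3, 2, 3, 1, 3, 0, 2, 1, 0, 3],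
    [0, 1, 2, 1, 0, 3, 2, 1, 2, 0, 3, 0, 2, 1, 2, 3, 2, 1, 3, 1, 2, 0, 1, 3, 0, 2, 3, 1, 0, 3, 2, 1, 2, 3, 2, 0, 3, 0, 1, 0, 2],
    [0, 1, 3, 2, 0, 2, 1, 3, 0, 3, 1, 0, 1, 3, 1, 2, 3, 2, 0, 2, 1, 0, 1, 2, 0, 2, 3, 2, 1, 3, 1, 2, 3, 0, 2, 0, 3, 0, 1, 2, 3, 1],
    [0, 1, 2, 1, 0, 1, 3, 0, 2, 3, 2, 1, 2, 0, 3, 0, 2, 3, 1, 2, 1, 3, 2, 3, 0, 2, 1, 0, 1, 2, 1, 3, 0, 1, 0, 2, 0, 3, 1, 0, 1, 3, 2]]"

definition frames5 :: "nat list list list" where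
  "frames5 =
   [[[], [0, 1, 2, 3, 4], [0, 2, 4, 1, 3], [0, 3, 1, 4, 2], [0, 4, 3, 2, 1]],
    [[1, 0, 4, 3, 2], [], [1, 2, 3, 4, 0], [1, 3, 0, 2, 4], [1, 4, 2, 0, 3]],
    [[2, 0, 3, 1, 4], [2, 1, 0, 4, 3], [], [2, 3, 4, 0, 1], [2, 4, 1, 3, 0]],
    [[3, 0, 2, 4, 1], [3, 1, 4, 2, 0], [3, 2, 1, 0, 4], [], [3, 4, 0, 1, 2]],
    [[4, 0, 1, 2, 3], [4, 1, 3, 0, 2], [4, 2, 0, 3, 1], [4, 3, 2, 1, 0], []]]"

definition unframes5 :: "nat list list list" where
  "unframes5 =
   [[[], [0, 1, 2, 3, 4], [0, 3, 1, 4, 2], [0, 2, 4, 1, 3], [0, 4, 3, 2, 1]],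
    [[1, 0, 4, 3, 2], [], [4, 0, 1, 2, 3], [2, 0, 3, 1, 4], [3, 0, 2, 4, 1]],
    [[1, 3, 0, 2, 4], [2, 1, 0, 4, 3], [], [3, 4, 0, 1, 2], [4, 2, 0, 3, 1]],
    [[1, 4, 2, 0, 3], [4, 1, 3, 0, 2], [3, 2, 1, 0, 4], [], [2, 3, 4, 0, 1]],
    [[1, 2, 3, 4, 0], [3, 1, 4, 2, 0], [2, 4, 1, 3, 0], [4, 3, 2, 1, 0], []]]"

definition block5 :: "nat list" where
  "block5 = [0, 2, 4, 3, 1, 2, 0, 3, 2, 4]"

definition inserts5 :: "nat list list" where
  "inserts5 =
   [[4, 0, 3, 2, 0, 1, 2, 3, 4],
    [4, 0, 1, 2, 3, 1, 0, 2, 1, 4],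
    [4, 0, 1, 2, 0, 4, 1, 0, 2, 1, 4],
    [4, 0, 3, 2, 0, 1, 2, 4, 0, 2, 1, 4],
    [4, 0, 1, 2, 0, 4, 1, 0, 3, 1, 2, 3, 4],
    [4, 0, 1, 2, 0, 4, 2, 1, 4, 3, 1, 2, 3, 4],
    [4, 0, 1, 2, 0, 3, 1, 0, 2, 3, 0, 4, 3, 1, 4],
    [4, 0, 1, 2, 0, 3, 1, 0, 2, 1, 4, 3, 1, 2, 3, 4],
    [4, 0, 1, 2, 0, 3, 1, 0, 2, 1, 3, 2, 0, 1, 2, 3, 4],
    [4, 0, 1, 2, 0, 3, 1, 0, 2, 1, 3, 2, 4, 3, 1, 2, 3, 4]]"

definition short5 :: "nat list list" where
  "short5 =
   [[0],
    [0, 1],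
    [0, 1, 2],
    [0, 1, 3, 2],
    [0, 1, 3, 2, 4],
    [0, 1, 2, 3, 1, 4],
    [0, 1, 2, 4, 3, 1, 4],
    [0, 1, 3, 2, 1, 4, 2, 3],
    [0, 1, 2, 0, 4, 1, 3, 2, 4],
    [0, 1, 4, 3, 0, 2, 4, 0, 3, 2],
    [0, 1, 3, 0, 4, 1, 0, 2, 3, 4, 2],
    [0, 1, 3, 4, 0, 3, 1, 2, 0, 4, 2, 3],
    [0, 1, 4, 3, 2, 1, 0, 3, 1, 2, 3, 4, 2],
    [0, 1, 2, 0, 3, 2, 4, 0, 2, 3, 4, 2, 1, 3],
    [0, 1, 4, 0, 3, 4, 2, 3, 1, 0, 2, 4, 1, 3, 2],
    [0, 1, 2, 3, 0, 2, 1, 3, 2, 4, 0, 2, 3, 1, 4, 2],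
    [0, 1, 4, 0, 3, 1, 0, 2, 3, 0, 1, 3, 2, 4, 3, 1, 2],
    [0, 1, 2, 3, 4, 1, 3, 2, 0, 4, 2, 1, 3, 0, 2, 3, 1, 4],
    [0, 1, 2, 4, 0, 2, 3, 4, 1, 2, 0, 4, 2, 3, 0, 2, 1, 3, 2],
    [0, 1, 3, 0, 4, 2, 0, 3, 1, 4, 0, 2, 3, 0, 4, 3, 2, 4, 1, 2],
    [0, 1, 2, 3, 4, 2, 1, 4, 0, 1, 3, 0, 2, 4, 0, 3, 2, 1, 0, 4, 3],
    [0, 1, 3, 2, 0, 3, 4, 2, 3, 1, 2, 0, 1, 4, 3, 1, 0, 2, 1, 4, 2, 3],
    [0, 1, 4, 3, 1, 2, 4, 1, 3, 4, 2, 1, 0, 2, 4, 0, 1, 2, 0, 4, 2, 1, 3],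
    [0, 1, 4, 0, 3, 2, 4, 3, 0, 2, 1, 3, 4, 1, 2, 4, 3, 2, 1, 0, 2, 3, 4, 2],
    [0, 1, 3, 2, 4, 0, 2, 1, 3, 0, 1, 2, 4, 1, 3, 2, 1, 4, 3, 1, 2, 0, 4, 2, 3],
    [0, 1, 3, 0, 2, 1, 4, 0, 3, 2, 0, 4, 3, 0, 2, 3, 4, 1, 2, 4, 0, 3, 1, 0, 4, 2],
    [0, 1, 3, 2, 1, 0, 3, 1, 4, 0, 1, 2, 3, 4, 2, 0, 4, 3, 0, 2, 1, 4, 2, 3, 4, 1, 2],
    [0, 1, 3, 4, 2, 3, 0, 4, 1, 3, 2, 1, 0, 2, 3, 4, 2, 1, 3, 0, 1, 4, 3, 2, 0, 3, 1, 4],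
    [0, 1, 3, 2, 4, 1, 0, 2, 3, 0, 1, 2, 4, 0, 2, 1, 4, 2, 3, 1, 0, 3, 2, 4, 3, 0, 4, 1, 2],
    [0, 1, 2, 0, 4, 2, 3, 1, 0, 2, 4, 0, 3, 2, 1, 0, 4, 2, 3, 4, 0, 1, 4, 3, 2, 0, 3, 4, 1, 3],
    [0, 1, 2, 3, 4, 1, 0, 4, 2, 1, 4, 3, 2, 0, 4, 1, 2, 4, 0, 3, 2, 1, 3, 0, 1, 4, 3, 1, 0, 3, 2],
    [0, 1, 3, 4, 0, 2, 1, 4, 3, 1, 0, 2, 3, 4, 2, 1, 3, 2, 0, 3, 4, 0, 2, 1, 0, 3, 1, 4, 2, 0, 4, 3],
    [0, 1, 2, 4, 0, 3, 2, 1, 0, 2, 3, 1, 4, 3, 0, 4, 2, 3, 4, 1, 3, 0, 2, 4, 3, 2, 0, 3, 1, 4, 0, 2, 3],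
    [0, 1, 3, 2, 1, 0, 3, 1, 2, 3, 0, 4, 1, 0, 2, 4, 0, 3, 1, 4, 2, 1, 0, 3, 4, 0, 2, 3, 1, 0, 4, 1, 2, 4],
    [0, 1, 2, 0, 3, 2, 1, 3, 0, 2, 4, 0, 3, 1, 0, 4, 1, 3, 2, 1, 4, 2, 0, 1, 2, 4, 1, 0, 3, 2, 0, 4, 3, 1, 4],
    [0, 1, 4, 3, 2, 0, 4, 2, 3, 1, 0, 3, 4, 2, 1, 3, 2, 4, 1, 2, 3, 4, 0, 3, 2, 1, 3, 0, 2, 4, 3, 1, 2, 0, 3, 4],
    [0, 1, 3, 0, 4, 3, 2, 0, 1, 2, 3, 4, 1, 0, 4, 3, 0, 2, 4, 0, 1, 4, 2, 0, 3, 4, 1, 0, 2, 4, 3, 2, 0, 4, 1, 2, 4],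
    [0, 1, 4, 0, 3, 4, 1, 3, 2, 4, 0, 2, 3, 0, 4, 1, 3, 4, 2, 0, 4, 3, 1, 4, 2, 1, 3, 0, 4, 1, 0, 3, 4, 0, 2, 3, 1, 2],
    [0, 1, 4, 3, 2, 1, 0, 2, 3, 4, 2, 1, 3, 0, 4, 1, 2, 3, 1, 4, 0, 1, 2, 0, 4, 2, 3, 0, 1, 3, 2, 1, 0, 3, 1, 2, 4, 1, 3],
    [0, 1, 2, 0, 3, 1, 0, 2, 4, 1, 2, 3, 4, 2, 0, 1, 4, 0, 2, 4, 3, 2, 0, 3, 1, 2, 4, 1, 3, 2, 1, 4, 0, 3, 4, 2, 0, 4, 1, 3],
    [0, 1, 2, 0, 4, 2, 3, 4, 0, 1, 4, 3, 1, 0, 4, 2, 0, 3, 1, 2, 4, 3, 0, 2, 1, 0, 3, 2, 4, 1, 3, 4, 0, 1, 2, 3, 1, 4, 2, 1, 3],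
    [0, 1, 3, 2, 0, 3, 1, 0, 4, 2, 1, 3, 2, 4, 1, 2, 0, 3, 1, 4, 3, 2, 4, 0, 3, 4, 2, 3, 0, 4, 3, 1, 2, 0, 1, 4, 0, 2, 1, 0, 3, 4],
    [0, 1, 4, 3, 2, 1, 0, 4, 1, 2, 3, 1, 0, 3, 4, 1, 3, 2, 0, 1, 4, 3, 1, 2, 4, 1, 3, 4, 2, 1, 4, 3, 2, 4, 0, 3, 1, 2, 0, 4, 1, 3, 4],
    [0, 1, 2, 4, 1, 0, 4, 3, 2, 4, 0, 2, 1, 3, 4, 2, 0, 1, 4, 3, 2, 1, 3, 0, 2, 3, 4, 1, 0, 4, 3, 1, 4, 0, 3, 2, 4, 3, 0, 2, 1, 4, 2, 3],
    [0, 1, 4, 2, 0, 4, 3, 1, 4, 0, 3, 2, 4, 1, 2, 0, 1, 4, 2, 3, 4, 1, 3, 0, 1, 2, 3, 1, 0, 2, 1, 3, 2, 0, 1, 2, 4, 0, 2, 1, 4, 3, 1, 2, 3],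
    [0, 1, 2, 0, 4, 1, 3, 4, 2, 0, 1, 2, 4, 3, 1, 0, 4, 2, 1, 3, 2, 0, 1, 2, 3, 1, 4, 3, 0, 4, 2, 0, 1, 3, 4, 1, 0, 4, 3, 1, 4, 0, 3, 4, 2, 3],
    [0, 1, 4, 2, 3, 1, 0, 4, 3, 2, 0, 3, 1, 2, 4, 1, 0, 4, 2, 0, 3, 4, 1, 3, 0, 2, 3, 1, 4, 2, 0, 4, 3, 2, 1, 0, 3, 1, 4, 3, 0, 1, 2, 0, 3, 2, 4],
    [0, 1, 2, 0, 3, 4, 2, 1, 4, 3, 0, 2, 3, 1, 2, 0, 3, 2, 1, 3, 0, 1, 2, 3, 1, 4, 3, 2, 0, 3, 4, 2, 3, 0, 4, 3, 1, 4, 2, 1, 3, 4, 1, 2, 3, 0, 2, 4]]"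

abbreviation "f4 \<equiv> \<lambda>a b. nth (frames4 ! a ! b)"
abbreviation "g4 \<equiv> \<lambda>a b. nth (unframes4 ! a ! b)"

lemma frame_maps4: "frame_maps 4 f4 g4"
  by (rule frame_check_maps) code_simp

text \<open>With windows of 7 letters the periods below 12 are checked directly, except 10; the
  bound \<open>(d + 1) * (w - 1)\<close> \<le> \<open>2 * length G\<close> reads 18 \<le>
  20.\<close>

lemma block_check4: "block_check 4 2 7 f4 block4"
  by code_simp

lemma window_check4: "list_all (window_check 4 2 7 7 f4 g4 block4) inserts4"
  by code_simp

lemma insert_check4: "list_all (insert_check 4 2 7 7 f4 block4) inserts4"
  by code_simp

lemma short_check4: "list_all (good_word_check 4 2) short4"
  by code_simp

abbreviation "f5 \<equiv> \<lambda>a b. nth (frames5 ! a ! b)"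
abbreviation "g5 \<equiv> \<lambda>a b. nth (unframes5 ! a ! b)"

lemma frame_maps5: "frame_maps 5 f5 g5"
  by (rule frame_check_maps) code_simp

text \<open>With windows of 6 letters the direct checks cover the periods below 15, except 10. Both
  20 \<le> 20 for the span and \<open>w - 1\<close> \<le> \<kappa> hold with equality.\<close>

lemma block_check5: "block_check 5 3 6 f5 block5"
  by code_simp

lemma window_check5: "list_all (window_check 5 3 6 5 f5 g5 block5) inserts5"
  by code_simp

lemma insert_check5: "list_all (insert_check 5 3 6 5 f5 block5) inserts5"
  by code_simp

lemma short_check5: "list_all (good_word_check 5 3) short5"
  by code_simp

lemma good_words_4:
  assumes n: "1 \<le> n"
  shows "\<exists>u. good 2 n u \<and> (\<forall>x. u x < (4 :: nat))"
proof (rule good_words_exist[where inserts = inserts4 and short = short4])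
  have L: "length block4 = 10" by code_simp
  show "substitution 4 2 7 7 f4 g4 block4 ys" if ys: "ys \<in> set inserts4" for ys
  proof
    have "list_all (\<lambda>i. block4 ! i \<noteq> block4 ! Suc i) [0..<9]" by code_simp
    then show "block4 ! i \<noteq> block4 ! Suc i" if "Suc i < length block4" for i
      using that unfolding L list_all_iff by auto
    have "list_all (\<lambda>ys. list_all (\<lambda>c. c < 4) ys \<and> length ys < 40) inserts4" by code_simp
    then show "set ys \<subseteq> {..<4}" "length ys < 4 * length block4"
      using ys unfolding L list_all_iff by auto
    have "list_all (\<lambda>c. c < 4) block4" by code_simp
    then show "set block4 \<subseteq> {..<4}" unfolding list_all_iff by auto
    show "window_check 4 2 7 7 f4 g4 block4 ys" "insert_check 4 2 7 7 f4 block4 ys"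
      using window_check4 insert_check4 ys unfolding list_all_iff by blast+
  qed (simp_all add: L frame_maps4 block_check4)
  \<comment> \<open>Ten consecutive lengths cover all residues modulo 10, and the short words reach
    up to length 43, just before the inductive step with m = 4 takes over.\<close>
  have "map length inserts4 = [4..<4+10]" "map length short4 = [1..<4 * 10 + 4]" by code_simp+
  then show "map length inserts4 = [4..<4 + length block4]"
    "map length short4 = [1..<4 * length block4 + 4]" unfolding L .
  show "0 < length block4" unfolding L by simp
qed (simp_all add: n[simplified] short_check4)

lemma good_words_5:
  assumes n: "1 \<le> n"
  shows "\<exists>u. good 3 n u \<and> (\<forall>x. u x < (5 :: nat))"
proof (rule good_words_exist[where inserts = inserts5 and short = short5])
  have L: "length block5 = 10" by code_simp
  show "substitution 5 3 6 5 f5 g5 block5 ys" if ys: "ys \<in> set inserts5" for ys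
  proof
    have "list_all (\<lambda>i. block5 ! i \<noteq> block5 ! Suc i) [0..<9]" by code_simp
    then show "block5 ! i \<noteq> block5 ! Suc i" if "Suc i < length block5" for i
      using that unfolding L list_all_iff by auto
    have "list_all (\<lambda>ys. list_all (\<lambda>c. c < 5) ys \<and> length ys < 40) inserts5" by code_simp
    then show "set ys \<subseteq> {..<5}" "length ys < 4 * length block5"
      using ys unfolding L list_all_iff by auto
    have "list_all (\<lambda>c. c < 5) block5" by code_simp
    then show "set block5 \<subseteq> {..<5}" unfolding list_all_iff by auto
    show "window_check 5 3 6 5 f5 g5 block5 ys" "insert_check 5 3 6 5 f5 block5 ys"
      using window_check5 insert_check5 ys unfolding list_all_iff by blast+
  qed (simp_all add: L frame_maps5 block_check5)
  have "map length inserts5 = [9..<9+10]" "map length short5 = [1..<4 * 10 + 9]" by code_simp+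
  then show "map length inserts5 = [9..<9 + length block5]"
    "map length short5 = [1..<4 * length block5 + 9]" unfolding L .
  show "0 < length block5" unfolding L by simp
qed (simp_all add: n[simplified] short_check5)

theorem mainTheorem1:
  shows "CRT_S 4 = ereal (3 / 2) \<and> CRT_S 5 = ereal (4 / 3)"
  using CRT_S_eq[of 4 2, OF _ _ _ good_words_4] CRT_S_eq[of 5 3, OF _ _ _ good_words_5] by simp

end
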